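(* For each $n\ge 1$ let $a_1,\dots,a_n$ be chosen independently and uniformly at random from $\{1,\dots,n\}$, and let $\pi=(n\ a_n)\cdots(2\ a_2)(1\ a_1)$. Then for each $k\ge 0$ the probability that $\pi$ has exactly $k$ fixed points converges, as $n\to\infty$, to a limit $p_k$, and these limits are given by $$\sum_{k\ge 0}p_k u^k=q(u),\qquad q(u)=\exp\Bigl(\tfrac12(u-1)\bigl(u e^{-2}-6e^{-1}+4-e^{-2}\bigr)\Bigr).$$
   Context: Permutations are composed from right to left; $(i\ j)$ denotes the transposition of $\{1,\dots,n\}$ exchanging $i$ and $j$, and $(i\ i)$ denotes the identity. Here $e$ is the base of natural logarithms. *)

theory Defs
  imports "HOL-Probability.Probability" "HOL-Combinatorics.Combinatorics"
begin

text \<open>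
  \<open>exchange_shuffle a n\<close> is the product \<open>(n a\<^sub>n) \<dots> (2 a\<^sub>2) (1 a\<^sub>1)\<close>, composed from right to
  left. The degenerate transposition \<open>(i i)\<close> is the identity, as in the library.
\<close>

primrec exchange_shuffle :: "(nat \<Rightarrow> nat) \<Rightarrow> nat \<Rightarrow> nat \<Rightarrow> nat" where
  "exchange_shuffle a 0 = id"
| "exchange_shuffle a (Suc m) = Transposition.transpose (Suc m) (a (Suc m)) \<circ> exchange_shuffle a m"

definition fixed_points :: "nat \<Rightarrow> (nat \<Rightarrow> nat) \<Rightarrow> nat set" where
  "fixed_points n f = {i \<in> {1..n}. f i = i}"

text \<open>
  The first argument of \<^const>\<open>Pi_pmf\<close> is the index set; the second is the irrelevant value of the
  sequence outside it.
\<close>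

definition choices_pmf :: "nat \<Rightarrow> (nat \<Rightarrow> nat) pmf" where
  "choices_pmf n = Pi_pmf {1..n} 0 (\<lambda>_. pmf_of_set {1..n})"

definition prob_fixed_points :: "nat \<Rightarrow> nat \<Rightarrow> real" where
  "prob_fixed_points n k =
     measure_pmf.prob (choices_pmf n) {a. card (fixed_points n (exchange_shuffle a n)) = k}"

definition q :: "complex \<Rightarrow> complex" where
  "q u = exp (1 / 2 * (u - 1) * (u * exp (-2) - 6 * exp (-1) + 4 - exp (-2)))"

end

theory Submission
  imports Defs
begin

text \<open>
  Follow the item that starts at position \<open>x\<close>. Step \<open>t\<close> exchanges the items at positions \<open>t\<close> and
  \<open>a\<^sub>t\<close>, so an item moves for one of two reasons: time reaches its position, or it is hit, which
  means that \<open>a\<^sub>t\<close> is its position, and then it goes to \<open>t\<close>. Once it lies at a position that time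
  has passed, it moves only when hit, and each hit takes it to a later position. It follows that an
  item that ends where it began has moved for one reason only. Either it was never hit: it went up
  through \<open>x = s\<^sub>1 < \<dots> < s\<^sub>k\<close>, leaving \<open>s\<^sub>i\<close> at time \<open>s\<^sub>i\<close>, and step \<open>s\<^sub>k\<close> brought it back to \<open>x\<close>. Or it was
  always hit: it dropped from \<open>x\<close> to some \<open>s\<^sub>1\<close> and climbed back through \<open>s\<^sub>1 < \<dots> < s\<^sub>k = x\<close>. Let
  \<open>S = {s\<^sub>1, \<dots>, s\<^sub>k}\<close>. In the first case \<open>a\<close> is on \<open>S\<close> the cyclic successor and \<open>x = Min S\<close>, in the
  second it is the cyclic predecessor and \<open>x = Max S\<close>; at a time outside \<open>S\<close> the only condition
  is that \<open>a\<^sub>t\<close> misses the current position of the item. A set with a direction is called a mark. For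
  a singleton the two directions describe the same item, so only one of them counts as a mark. Fixed
  points thus correspond to the marks that \<open>a\<close> realises (\<open>card_fixed_points\<close>).

  Different marks realised by the same \<open>a\<close> are on disjoint sets, except that a two-element set may
  carry both of its marks (\<open>compatible_realised\<close>). If \<open>r\<close> compatible marks cover \<open>L\<close> positions,
  then realising them prescribes \<open>a\<close> on these positions and forbids \<open>r\<close> different values at each of
  the others, so \<open>(n - r) ^ (n - L)\<close> of the \<open>n ^ n\<close> sequences do it (\<open>card_choices_realising\<close>). A block of
  one element allows one mark; a block of \<open>k \<ge> 2\<close> elements allows two, and for \<open>k = 2\<close>
  both together as well. Compatible sets of marks are therefore counted by the exponential generating
  function \<open>exp (v * (2 * exp z - 2 - z) + v\<^sup>2 * z\<^sup>2 / 2)\<close>, where \<open>z\<close> counts positions and \<open>v\<close>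
  counts marks (\<open>sum_configurations\<close>).

  Let \<open>X\<close> be the number of fixed points. Since \<open>n (n - 1) \<dots> (n - L + 1) (n - r) ^ (n - L) / n ^ n\<close> is
  at most 1 and tends to \<open>exp (- r)\<close>, setting \<open>z = 1\<close> shows that the expectation of \<open>X choose r\<close> tends
  to the coefficient of \<open>v ^ r\<close> in \<open>exp ((2 * e - 3) * (v / e) + (v / e)\<^sup>2 / 2)\<close>, which is
  \<open>q (1 + v)\<close> (\<open>binomial_moment_tendsto\<close>, \<open>config_total_power_series\<close>). The expectations are
  bounded, uniformly in \<open>n\<close>, by the coefficients of an entire function. Hence the inversion formula
  that expresses the probability of \<open>X = k\<close> by these expectations passes to the limit term by
  term (\<open>prob_fixed_points_tendsto\<close>), and summing it over \<open>k\<close> replaces \<open>v\<close> by \<open>u - 1\<close>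
  (\<open>binomial_inversion_sums\<close>).
\<close>

section \<open>Items that return to their starting position\<close>

definition cyc_succ :: "nat set \<Rightarrow> nat \<Rightarrow> nat" where
  "cyc_succ S t = (if {s \<in> S. t < s} = {} then Min S else Min {s \<in> S. t < s})"

definition cyc_pred :: "nat set \<Rightarrow> nat \<Rightarrow> nat" where
  "cyc_pred S t = (if {s \<in> S. s < t} = {} then Max S else Max {s \<in> S. s < t})"

definition cyc_step :: "bool \<Rightarrow> nat set \<Rightarrow> nat \<Rightarrow> nat" where
  "cyc_step d = (if d then cyc_succ else cyc_pred)"

lemma cyc_succ_mem:
  assumes "finite S" "S \<noteq> {}"
  shows "cyc_succ S t \<in> S"
  using assms Min_in[of S] Min_in[of "{s \<in> S. t < s}"] by (auto simp: cyc_succ_def)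

lemma cyc_pred_mem:
  assumes "finite S" "S \<noteq> {}"
  shows "cyc_pred S t \<in> S"
  using assms Max_in[of S] Max_in[of "{s \<in> S. s < t}"] by (auto simp: cyc_pred_def)

lemma cyc_step_mem: "finite S \<Longrightarrow> S \<noteq> {} \<Longrightarrow> cyc_step d S t \<in> S"
  by (simp add: cyc_step_def cyc_succ_mem cyc_pred_mem)

text \<open>
  Regard \<open>cyc_succ S m\<close> as the position, after step \<open>m\<close>, of an item that starts at \<open>Min S\<close> and leaves
  each element of \<open>S\<close> when time reaches it. In the same way \<open>cyc_pred S (Suc m)\<close> is the position after
  step \<open>m\<close> of an item that starts at \<open>Max S\<close> and is hit exactly at the times in \<open>S\<close>. The next
  lemmas describe one step of these motions and their ends.
\<close>

lemma cyc_succ_next: "finite S \<Longrightarrow> Suc m \<in> S \<Longrightarrow> cyc_succ S m = Suc m"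
  by (auto simp: cyc_succ_def intro!: Min_eqI)

lemma cyc_succ_skip:
  assumes "Suc m \<notin> S"
  shows "cyc_succ S m = cyc_succ S (Suc m)"
proof -
  have "{s \<in> S. m < s} = {s \<in> S. Suc m < s}"
    using assms by (auto intro!: Suc_lessI)
  then show ?thesis by (simp only: cyc_succ_def)
qed

lemma cyc_succ_ends:
  assumes "S \<subseteq> {1..n}"
  shows "cyc_succ S 0 = Min S" and "cyc_succ S n = Min S"
proof -
  have "{s \<in> S. 0 < s} = S" "{s \<in> S. n < s} = {}" using assms by force+
  then show "cyc_succ S 0 = Min S" and "cyc_succ S n = Min S"
    by (simp_all add: cyc_succ_def)
qed

lemma cyc_pred_next: "finite S \<Longrightarrow> t \<in> S \<Longrightarrow> cyc_pred S (Suc t) = t"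
  by (auto simp: cyc_pred_def intro!: Max_eqI)

lemma cyc_pred_skip:
  assumes "t \<notin> S"
  shows "cyc_pred S (Suc t) = cyc_pred S t"
proof -
  have "{s \<in> S. s < Suc t} = {s \<in> S. s < t}"
    using assms by (auto simp: less_Suc_eq)
  then show ?thesis by (simp only: cyc_pred_def)
qed

lemma cyc_pred_ends:
  assumes "S \<subseteq> {1..n}"
  shows "cyc_pred S (Suc 0) = Max S" and "cyc_pred S (Suc n) = Max S"
proof -
  have "{s \<in> S. s < Suc 0} = {}" "{s \<in> S. s < Suc n} = S" using assms by force+
  then show "cyc_pred S (Suc 0) = Max S" and "cyc_pred S (Suc n) = Max S"
    by (simp_all add: cyc_pred_def)
qed

text \<open>
  The flag is true for the increasing direction. Both directions of a singleton would mark the same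
  fixed point, so the decreasing one is excluded.
\<close>

definition marks :: "nat set \<Rightarrow> (nat set \<times> bool) set" where
  "marks U = {(S, d). S \<subseteq> U \<and> S \<noteq> {} \<and> (d \<or> 2 \<le> card S)}"

text \<open>
  For \<open>t \<notin> S\<close> the value \<open>cyc_step d S t\<close> is the position of the marked item just before step \<open>t\<close>, and
  \<open>a t\<close> has to miss it.
\<close>

definition realised :: "nat \<Rightarrow> (nat \<Rightarrow> nat) \<Rightarrow> (nat set \<times> bool) set" where
  "realised n a =
     {(S, d) \<in> marks {1..n}. \<forall>t\<in>{1..n}. a t = cyc_step d S t \<longleftrightarrow> t \<in> S}"

definition marked_point :: "nat set \<times> bool \<Rightarrow> nat" where
  "marked_point f = (if snd f then Min (fst f) else Max (fst f))"

lemma marks_finite: "(S, d) \<in> marks U \<Longrightarrow> finite U \<Longrightarrow> finite S \<and> S \<noteq> {}"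
  by (auto simp: marks_def intro: finite_subset)

lemma shuffle_step:
  "exchange_shuffle a (Suc m) x =
     (if exchange_shuffle a m x = Suc m then a (Suc m)
      else if exchange_shuffle a m x = a (Suc m) then Suc m
      else exchange_shuffle a m x)"
  by (simp add: Transposition.transpose_def)

declare exchange_shuffle.simps(2) [simp del]

lemma inj_exchange_shuffle: "inj (exchange_shuffle a m)"
proof (induction m)
  case (Suc m)
  then show ?case
    unfolding exchange_shuffle.simps(2) by (intro inj_compose inj_on_transpose) 
qed simp

lemma trajectory_succ:
  assumes "(S, True) \<in> realised n a" "m \<le> n"
  shows "exchange_shuffle a m (Min S) = cyc_succ S m"
proof -
  have S: "S \<subseteq> {1..n}" "S \<noteq> {}"
    and a: "\<And>t. t \<in> {1..n} \<Longrightarrow> a t = cyc_succ S t \<longleftrightarrow> t \<in> S"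
    using assms(1) by (auto simp: realised_def marks_def cyc_step_def)
  have fin: "finite S" using S(1) by (rule finite_subset) simp
  show ?thesis
    using assms(2)
  proof (induction m)
    case 0
    then show ?case by (simp add: cyc_succ_ends[OF S(1)])
  next
    case (Suc m)
    then have IH: "exchange_shuffle a m (Min S) = cyc_succ S m" by simp
    have t: "Suc m \<in> {1..n}" using Suc.prems by simp
    show ?case
    proof (cases "Suc m \<in> S")
      case True
      then show ?thesis
        using a[OF t] by (simp add: shuffle_step IH cyc_succ_next[OF fin])
    next
      case False
      then have "cyc_succ S (Suc m) \<noteq> Suc m"
        using cyc_succ_mem[OF fin S(2), of "Suc m"] by auto
      then show ?thesis
        using a[OF t] False by (auto simp: shuffle_step IH cyc_succ_skip[OF False])
    qed
  qed
qed

lemma trajectory_pred: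
  assumes "(S, False) \<in> realised n a" "m \<le> n"
  shows "exchange_shuffle a m (Max S) = cyc_pred S (Suc m)"
proof -
  have S: "S \<subseteq> {1..n}" "S \<noteq> {}"
    and a: "\<And>t. t \<in> {1..n} \<Longrightarrow> a t = cyc_pred S t \<longleftrightarrow> t \<in> S"
    using assms(1) by (auto simp: realised_def marks_def cyc_step_def)
  have fin: "finite S" using S(1) by (rule finite_subset) simp
  show ?thesis
    using assms(2)
  proof (induction m)
    case 0
    then show ?case by (simp add: cyc_pred_ends[OF S(1)])
  next
    case (Suc m)
    then have IH: "exchange_shuffle a m (Max S) = cyc_pred S (Suc m)" by simp
    have t: "Suc m \<in> {1..n}" using Suc.prems by simp
    show ?case
    proof (cases "Suc m \<in> S")
      case True
      then show ?thesis
        using a[OF t] by (auto simp add: shuffle_step IH cyc_pred_next[OF fin])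
    next
      case False
      then have "cyc_pred S (Suc m) \<noteq> Suc m"
        using cyc_pred_mem[OF fin S(2), of "Suc m"] by auto
      then show ?thesis
        using a[OF t] False by (auto simp: shuffle_step IH cyc_pred_skip[OF False])
    qed
  qed
qed

lemma marked_point_fixed:
  assumes "f \<in> realised n a"
  shows "marked_point f \<in> fixed_points n (exchange_shuffle a n)"
proof -
  obtain S d where f: "f = (S, d)" by fastforce
  have S: "S \<subseteq> {1..n}" "S \<noteq> {}" using assms f by (auto simp: realised_def marks_def)
  have fin: "finite S" using S(1) by (rule finite_subset) simp
  have "Min S \<in> {1..n}" "Max S \<in> {1..n}"
    using Min_in[OF fin S(2)] Max_in[OF fin S(2)] S(1) by auto
  then show ?thesis
    using trajectory_succ[of S n a n] trajectory_pred[of S n a n] assms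
    by (cases d) (auto simp: f fixed_points_def marked_point_def cyc_succ_ends[OF S(1)]
        cyc_pred_ends[OF S(1)])
qed

text \<open>
  At a position that time has passed, an item can only be hit, and a hit at time \<open>t\<close> takes it to \<open>t\<close>.
\<close>

lemma stays_in_past:
  assumes "exchange_shuffle a m x \<le> m" "m \<le> m'"
  shows "exchange_shuffle a m' x = exchange_shuffle a m x
         \<or> m < exchange_shuffle a m' x \<and> exchange_shuffle a m' x \<le> m'"
  using assms(2)
proof (induction m' rule: dec_induct)
  case (step k)
  then show ?case using assms(1) by (auto simp: shuffle_step)
qed simp

text \<open>
  An item that lies ahead of time has always been ahead of time, hence has never been hit, and each
  move from \<open>t\<close> at time \<open>t\<close> took it further up.
\<close>

lemma future_increases:
  assumes "m < exchange_shuffle a m x"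
  shows "x \<le> exchange_shuffle a m x"
  using assms
proof (induction m)
  case (Suc m)
  have "m < exchange_shuffle a m x"
    using stays_in_past[of a m x "Suc m"] Suc.prems by linarith
  with Suc show ?case by (auto simp: shuffle_step split: if_splits)
qed simp

text \<open>
  Suppose that the item moved for both reasons: time reached it at \<open>Suc k\<close>, and it was hit at
  \<open>Suc l\<close>. It was not overtaken by time before step \<open>Suc k\<close>, so this step comes first, and
  \<open>x \<le> Suc k\<close> because it only moved up until then. After the hit it never returns below \<open>Suc l > Suc k\<close>,
  so it cannot end at \<open>x\<close>.
\<close>

lemma fixed_item_moves_one_way:
  assumes "exchange_shuffle a n x = x"
  shows "(\<forall>m<n. exchange_shuffle a m x \<noteq> Suc m) \<or>
         (\<forall>m<n. exchange_shuffle a m x \<noteq> Suc m \<longrightarrow> a (Suc m) \<noteq> exchange_shuffle a m x)"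
proof (rule ccontr)
  assume "\<not> ?thesis"
  then obtain k l where k: "k < n" "exchange_shuffle a k x = Suc k"
    and l: "l < n" "exchange_shuffle a l x \<noteq> Suc l" "a (Suc l) = exchange_shuffle a l x"
    by blast
  have yl: "exchange_shuffle a (Suc l) x = Suc l" using l by (simp add: shuffle_step)
  have "x \<le> Suc k" using future_increases[of k a x] k by simp
  moreover have "k < l"
    using stays_in_past[of a "Suc l" x k] yl k l by (cases k l rule: linorder_cases) auto
  moreover have "Suc l \<le> x"
    using stays_in_past[of a "Suc l" x n] yl l assms by auto
  ultimately show False by simp
qed

text \<open>
  If the item is never hit, let \<open>S\<close> be the set of times that reach it; its position after step \<open>m\<close> is
  found by induction downwards from the end, where it is \<open>x\<close>. If time never reaches it, let
  \<open>S\<close> be the set of times that hit it and use induction upwards from the start. Reversal of time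
  exchanges the two arguments. The condition at the opposite end then identifies \<open>x\<close> as \<open>Min S\<close>
  or \<open>Max S\<close>.
\<close>

lemma fixed_point_marked:
  assumes x: "x \<in> fixed_points n (exchange_shuffle a n)"
  shows "\<exists>f \<in> realised n a. marked_point f = x"
proof -
  define y where "y m = exchange_shuffle a m x" for m
  have y0: "y 0 = x" and yn: "y n = x" and xn: "x \<in> {1..n}"
    using x by (auto simp: y_def fixed_points_def)
  have y_Suc: "y (Suc m) = (if y m = Suc m then a (Suc m)
                else if y m = a (Suc m) then Suc m else y m)" for m
    by (simp add: y_def shuffle_step)
  have frozen: "y m = x" if "\<forall>k<n. y k \<noteq> Suc k \<and> y k \<noteq> a (Suc k)" "m \<le> n" for m
    using that(2) by (induction m) (use that(1) y0 y_Suc in auto)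
  \<comment> \<open>An item that never moves is still reached by time at step \<open>x\<close>; this makes \<open>S\<close> nonempty.\<close>
  have active: "\<exists>k<n. y k = Suc k \<or> y k = a (Suc k)"
  proof (rule ccontr)
    assume "\<not> ?thesis"
    then have *: "\<forall>k<n. y k \<noteq> Suc k \<and> y k \<noteq> a (Suc k)" by blast
    have "y (x - 1) = x" using xn by (intro frozen[OF *]) auto
    then show False using * xn by (metis One_nat_def Suc_pred atLeastAtMost_iff
          less_eq_Suc_le)
  qed
  have "(\<forall>m<n. y m \<noteq> Suc m) \<or> (\<forall>m<n. y m \<noteq> Suc m \<longrightarrow> a (Suc m) \<noteq> y m)"
    using fixed_item_moves_one_way[of a n x] yn by (simp add: y_def)
  then consider (pred) "\<forall>m<n. y m \<noteq> Suc m"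
    | (succ) "\<forall>m<n. y m \<noteq> Suc m \<longrightarrow> a (Suc m) \<noteq> y m" by blast
  then show ?thesis
  proof cases
    case succ
    define S where "S = {t \<in> {1..n}. y (t - 1) = t}"
    have Sn: "S \<subseteq> {1..n}" and fin: "finite S" by (auto simp: S_def)
    have S_Suc: "Suc m \<in> S \<longleftrightarrow> y m = Suc m" if "m < n" for m using that by (auto simp: S_def)
    have ne: "S \<noteq> {}" using active succ S_Suc by (metis empty_iff)
    define h where "h m = (if {s \<in> S. m < s} = {} then x else Min {s \<in> S. m < s})" for m
    have yh: "y m = h m" if "m \<le> n" for m
      using that
    proof (induction m rule: inc_induct)
      case base
      have "{s \<in> S. n < s} = {}" using Sn by force
      then show ?case by (simp add: h_def yn)
    next
      case (step k)
      show ?case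
      proof (cases "Suc k \<in> S")
        case True
        then have "h k = Suc k" using fin by (auto simp: h_def intro!: Min_eqI)
        with True S_Suc step show ?thesis by simp
      next
        case False
        then have "{s \<in> S. k < s} = {s \<in> S. Suc k < s}" by (auto intro!: Suc_lessI)
        then have "h k = h (Suc k)" by (simp only: h_def)
        moreover have "y (Suc k) = y k"
          using False S_Suc[of k] step succ y_Suc[of k] by auto
        ultimately show ?thesis using step by simp
      qed
    qed
    have "{s \<in> S. 0 < s} = S" using Sn by force
    then have xS: "Min S = x" using yh[of 0] y0 ne by (simp add: h_def)
    have hs: "h m = cyc_succ S m" for m by (simp only: h_def cyc_succ_def xS)
    have "a t = cyc_succ S t \<longleftrightarrow> t \<in> S" if t: "t \<in> {1..n}" for t
    proof -
      obtain m where m: "t = Suc m" "m < n" using t by (cases t) auto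
      show ?thesis
        using yh[of t] hs[of t] y_Suc[of m] S_Suc[of m] succ m by auto
    qed
    then have R: "(S, True) \<in> realised n a"
      using Sn ne by (auto simp: realised_def marks_def cyc_step_def)
    show ?thesis using xS by (intro bexI[OF _ R]) (simp add: marked_point_def)
  next
    case pred
    define S where "S = {t \<in> {1..n}. a t = y (t - 1)}"
    have Sn: "S \<subseteq> {1..n}" and fin: "finite S" by (auto simp: S_def)
    have S_Suc: "Suc m \<in> S \<longleftrightarrow> a (Suc m) = y m" if "m < n" for m using that by (auto simp: S_def)
    have ne: "S \<noteq> {}" using active pred S_Suc by (metis empty_iff)
    define h where "h t = (if {s \<in> S. s < t} = {} then x else Max {s \<in> S. s < t})" for t
    have yh: "y m = h (Suc m)" if "m \<le> n" for m
      using that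
    proof (induction m)
      case 0
      have "{s \<in> S. s < Suc 0} = {}" using Sn by force
      then show ?case by (simp add: h_def y0)
    next
      case (Suc k)
      have yk: "y k \<noteq> Suc k" using pred Suc.prems by auto
      show ?case
      proof (cases "Suc k \<in> S")
        case True
        then have "h (Suc (Suc k)) = Suc k" using fin by (auto simp: h_def intro!: Max_eqI)
        with True S_Suc[of k] Suc yk y_Suc[of k] show ?thesis by simp
      next
        case False
        then have "{s \<in> S. s < Suc (Suc k)} = {s \<in> S. s < Suc k}" by (auto simp: less_Suc_eq)
        then have "h (Suc (Suc k)) = h (Suc k)" by (simp only: h_def)
        with False S_Suc[of k] Suc yk y_Suc[of k] show ?thesis by auto
      qed
    qed
    have "{s \<in> S. s < Suc n} = S" using Sn by force
    then have xS: "Max S = x" using yh[of n] yn ne by (simp add: h_def)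
    have hs: "h m = cyc_pred S m" for m by (simp only: h_def cyc_pred_def xS)
    have at: "a t = cyc_pred S t \<longleftrightarrow> t \<in> S" if t: "t \<in> {1..n}" for t
    proof -
      obtain m where m: "t = Suc m" "m < n" using t by (cases t) auto
      show ?thesis
        using yh[of m] hs[of t] S_Suc[of m] m by auto
    qed
    \<comment> \<open>If \<open>S\<close> were a singleton, the item would be at \<open>x\<close> when time reaches \<open>x\<close>.\<close>
    have "2 \<le> card S"
    proof (rule ccontr)
      assume "\<not> 2 \<le> card S"
      then have "card S = 1" using ne fin by (metis One_nat_def Suc_leI card_gt_0_iff le_antisym
            not_less_eq_eq numeral_2_eq_2)
      then have "S = {x}" using xS by (metis Max_singleton card_1_singletonE)
      then have "h x = x" by (auto simp: h_def)
      then show False using yh[of "x - 1"] pred xn by (auto dest: spec[of _ "x - 1"])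
    qed
    then have R: "(S, False) \<in> realised n a"
      using Sn ne at by (auto simp: realised_def marks_def cyc_step_def)
    show ?thesis using xS by (intro bexI[OF _ R]) (simp add: marked_point_def)
  qed
qed

text \<open>
  The trajectory of the item determines its set: the times that reach it, or the times that hit it.
  If \<open>x\<close> had marks of both directions, then time would reach the item at time \<open>x\<close>, and the
  decreasing set could have no element below its maximum.
\<close>

lemma inj_on_marked_point: "inj_on marked_point (realised n a)"
proof -
  have succ_set: "S = {t \<in> {1..n}. exchange_shuffle a (t - 1) (Min S) = t}"
    if f: "(S, True) \<in> realised n a" for S
  proof -
    have S: "S \<subseteq> {1..n}" "S \<noteq> {}" using f by (auto simp: realised_def marks_def)
    have fin: "finite S" using S(1) by (rule finite_subset) simp
    have "t \<in> S \<longleftrightarrow> exchange_shuffle a (t - 1) (Min S) = t" if t: "t \<in> {1..n}" for t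
    proof -
      obtain m where m: "t = Suc m" using t by (cases t) auto
      then show ?thesis
        using t trajectory_succ[OF f, of m] cyc_succ_next[OF fin, of m]
          cyc_succ_mem[OF fin S(2), of m] by auto
    qed
    then show ?thesis using S(1) by blast
  qed
  have pred_set: "S = {t \<in> {1..n}. exchange_shuffle a (t - 1) (Max S) = a t}"
    if f: "(S, False) \<in> realised n a" for S
  proof -
    have S: "S \<subseteq> {1..n}" "S \<noteq> {}"
      and at: "\<And>t. t \<in> {1..n} \<Longrightarrow> a t = cyc_pred S t \<longleftrightarrow> t \<in> S"
      using f by (auto simp: realised_def marks_def cyc_step_def)
    have "t \<in> S \<longleftrightarrow> exchange_shuffle a (t - 1) (Max S) = a t" if t: "t \<in> {1..n}" for t
    proof -
      obtain m where m: "t = Suc m" using t by (cases t) auto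
      then show ?thesis
        using t trajectory_pred[OF f, of m] at[OF t] by auto
    qed
    then show ?thesis using S(1) by blast
  qed
  have mixed: False if f: "(S, True) \<in> realised n a" and g: "(T, False) \<in> realised n a"
    and eq: "Min S = Max T" for S T
  proof -
    have S: "S \<subseteq> {1..n}" "S \<noteq> {}" and T: "T \<subseteq> {1..n}" "2 \<le> card T"
      using f g by (auto simp: realised_def marks_def)
    have fS: "finite S" and fT: "finite T" using S T finite_subset by blast+
    have xS: "Min S \<in> S" using fS S(2) by simp
    then obtain m where m: "Min S = Suc m" "m < n" using S(1) by (cases "Min S") auto
    have "cyc_succ S m = Suc m" using cyc_succ_next[OF fS, of m] xS m by simp
    then have *: "cyc_pred T (Suc m) = Suc m"
      using trajectory_succ[OF f, of m] trajectory_pred[OF g, of m] eq m by simp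
    have "{s \<in> T. s < Suc m} = {}"
    proof (rule ccontr)
      assume ne: "{s \<in> T. s < Suc m} \<noteq> {}"
      then have "Max {s \<in> T. s < Suc m} \<in> {s \<in> T. s < Suc m}"
        using fT by (intro Max_in) auto
      then show False using * unfolding cyc_pred_def if_not_P[OF ne] by simp
    qed
    moreover have "\<forall>s\<in>T. s \<le> Suc m" using fT eq m by (metis Max_ge)
    ultimately have "T \<subseteq> {Suc m}" by force
    then show False using card_mono[of "{Suc m}" T] T(2) by simp
  qed
  show ?thesis
  proof (rule inj_onI)
    fix f g
    assume f: "f \<in> realised n a" and g: "g \<in> realised n a"
      and eq: "marked_point f = marked_point g"
    obtain S d T e where fg: "f = (S, d)" "g = (T, e)" by fastforce
    show "f = g"
    proof (cases "d = e")
      case True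
      have "S = T"
      proof (cases e)
        case True
        have "Min S = Min T" using eq fg \<open>d = e\<close> True by (simp add: marked_point_def)
        have "S = {t \<in> {1..n}. exchange_shuffle a (t - 1) (Min S) = t}"
          using f fg \<open>d = e\<close> True by (intro succ_set) simp
        also have "\<dots> = {t \<in> {1..n}. exchange_shuffle a (t - 1) (Min T) = t}"
          by (simp only: \<open>Min S = Min T\<close>)
        also have "\<dots> = T" using g fg True by (intro succ_set[symmetric]) simp
        finally show ?thesis .
      next
        case False
        have "Max S = Max T" using eq fg \<open>d = e\<close> False by (simp add: marked_point_def)
        have "S = {t \<in> {1..n}. exchange_shuffle a (t - 1) (Max S) = a t}"
          using f fg \<open>d = e\<close> False by (intro pred_set) simp
        also have "\<dots> = {t \<in> {1..n}. exchange_shuffle a (t - 1) (Max T) = a t}"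
          by (simp only: \<open>Max S = Max T\<close>)
        also have "\<dots> = T" using g fg False by (intro pred_set[symmetric]) simp
        finally show ?thesis .
      qed
      then show ?thesis using fg True by simp
    next
      case False
      then show ?thesis
        using mixed[of S T] mixed[of T S] f g eq fg by (cases e) (auto simp: marked_point_def)
    qed
  qed
qed

lemma card_fixed_points:
  "card (fixed_points n (exchange_shuffle a n)) = card (realised n a)"
proof -
  have "fixed_points n (exchange_shuffle a n) = marked_point ` realised n a"
    using marked_point_fixed fixed_point_marked by fast
  then show ?thesis by (simp add: card_image inj_on_marked_point)
qed

section \<open>Several marks at once\<close>

text \<open>
  Two different marks on the same set have opposite directions, so a set carries at most two.
\<close>

definition compatible :: "(nat set \<times> bool) set \<Rightarrow> bool" where
  "compatible F \<longleftrightarrow>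
     (\<forall>f\<in>F. \<forall>g\<in>F. f \<noteq> g \<longrightarrow> fst f \<inter> fst g = {} \<or> fst f = fst g \<and> card (fst f) = 2)"

definition covered :: "(nat set \<times> bool) set \<Rightarrow> nat set" where
  "covered F = (\<Union>f\<in>F. fst f)"

lemma compatible_subset: "compatible G \<Longrightarrow> F \<subseteq> G \<Longrightarrow> compatible F"
  unfolding compatible_def by blast

lemma compatibleD:
  "compatible F \<Longrightarrow> (S, d) \<in> F \<Longrightarrow> (T, e) \<in> F \<Longrightarrow> (S, d) \<noteq> (T, e) \<Longrightarrow>
     S \<inter> T = {} \<or> S = T \<and> card S = 2 \<and> d \<noteq> e"
  unfolding compatible_def by fastforce

lemma cyc_succ_le:
  assumes "finite S" "cyc_succ S t \<le> t"
  shows "cyc_succ S t = Min S" "\<And>s. s \<in> S \<Longrightarrow> s \<le> t"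
proof -
  have "{s \<in> S. t < s} = {}"
  proof (rule ccontr)
    assume ne: "{s \<in> S. t < s} \<noteq> {}"
    then have "Min {s \<in> S. t < s} \<in> {s \<in> S. t < s}" using assms(1) by (intro Min_in) auto
    then show False using assms(2) unfolding cyc_succ_def if_not_P[OF ne] by simp
  qed
  then show "cyc_succ S t = Min S" "\<And>s. s \<in> S \<Longrightarrow> s \<le> t"
    by (auto simp: cyc_succ_def not_less)
qed

lemma cyc_pred_ge:
  assumes "finite S" "t \<le> cyc_pred S t"
  shows "cyc_pred S t = Max S" "\<And>s. s \<in> S \<Longrightarrow> t \<le> s"
proof -
  have "{s \<in> S. s < t} = {}"
  proof (rule ccontr)
    assume ne: "{s \<in> S. s < t} \<noteq> {}"
    then have "Max {s \<in> S. s < t} \<in> {s \<in> S. s < t}" using assms(1) by (intro Max_in) auto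
    then show False using assms(2) unfolding cyc_pred_def if_not_P[OF ne] by simp
  qed
  then show "cyc_pred S t = Max S" "\<And>s. s \<in> S \<Longrightarrow> t \<le> s"
    by (auto simp: cyc_pred_def not_less)
qed

lemma cyc_succ_least:
  assumes "finite S" "s \<in> S" "t < s"
  shows "t < cyc_succ S t" "cyc_succ S t \<le> s"
proof -
  show "t < cyc_succ S t" using cyc_succ_le(2)[OF assms(1) _ assms(2)] assms(3) by (meson not_less)
  have ne: "{s \<in> S. t < s} \<noteq> {}" using assms by auto
  show "cyc_succ S t \<le> s" unfolding cyc_succ_def if_not_P[OF ne] using assms by (intro Min_le) auto
qed

lemma cyc_pred_greatest:
  assumes "finite S" "s \<in> S" "s < t"
  shows "cyc_pred S t < t" "s \<le> cyc_pred S t"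
proof -
  show "cyc_pred S t < t" using cyc_pred_ge(2)[OF assms(1) _ assms(2)] assms(3) by (meson not_less)
  have ne: "{s \<in> S. s < t} \<noteq> {}" using assms by auto
  show "s \<le> cyc_pred S t" unfolding cyc_pred_def if_not_P[OF ne] using assms by (intro Max_ge) auto
qed

lemma realisedD:
  assumes "(S, d) \<in> realised n a"
  shows "S \<subseteq> {1..n}" "finite S" "S \<noteq> {}" "\<And>t. t \<in> S \<Longrightarrow> a t = cyc_step d S t"
    "\<not> d \<Longrightarrow> 2 \<le> card S"
proof -
  show S: "S \<subseteq> {1..n}" "S \<noteq> {}" "\<not> d \<Longrightarrow> 2 \<le> card S"
    using assms by (auto simp: realised_def marks_def)
  then show "finite S" using finite_subset by blast
  show "\<And>t. t \<in> S \<Longrightarrow> a t = cyc_step d S t"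
    using assms S(1) by (auto simp: realised_def)
qed

text \<open>
  Two items that share an element \<open>s\<close> of their sets are both at position \<open>s\<close> just before step \<open>s\<close> (or
  both just after it), so they are the same item.
\<close>

lemma realised_overlap_same:
  assumes f: "(S, d) \<in> realised n a" and g: "(T, d) \<in> realised n a" and s: "s \<in> S" "s \<in> T"
  shows "S = T"
proof -
  note S = realisedD[OF f] and T = realisedD[OF g]
  obtain m where m: "s = Suc m" "m < n" using s S(1) by (cases s) auto
  have "marked_point (S, d) = marked_point (T, d)"
  proof (cases d)
    case True
    have "exchange_shuffle a m (Min S) = exchange_shuffle a m (Min T)"
      using trajectory_succ[of S n a m] trajectory_succ[of T n a m] f g True m s
        cyc_succ_next[of S m] cyc_succ_next[of T m] S(2) T(2) by simp
    then show ?thesis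
      using True inj_exchange_shuffle[of a m] by (simp add: marked_point_def inj_eq)
  next
    case False
    have "exchange_shuffle a s (Max S) = exchange_shuffle a s (Max T)"
      using trajectory_pred[of S n a s] trajectory_pred[of T n a s] f g False m s
        cyc_pred_next[of S s] cyc_pred_next[of T s] S(2) T(2) by simp
    then show ?thesis
      using False inj_exchange_shuffle[of a s] by (simp add: marked_point_def inj_eq)
  qed
  then show ?thesis using inj_onD[OF inj_on_marked_point _ f g] by simp
qed

text \<open>
  The map \<open>a\<close> sends \<open>S \<inter> T\<close> into itself, where it is both the successor in \<open>S\<close> and the predecessor in
  \<open>T\<close>. At its maximum it cannot go up, and so wraps around in \<open>S\<close>; at its minimum it cannot go down, and
  so wraps around in \<open>T\<close>. Hence the minimum and the maximum are common to \<open>S\<close> and \<open>T\<close> and are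
  exchanged by \<open>a\<close>, which leaves no room for elements between them. They differ because \<open>T\<close> is not
  a singleton.
\<close>

lemma realised_overlap_opposite:
  assumes f: "(S, True) \<in> realised n a" and g: "(T, False) \<in> realised n a"
    and "S \<inter> T \<noteq> {}"
  shows "S = T \<and> card S = 2"
proof -
  note S = realisedD[OF f] and T = realisedD[OF g]
  define X where "X = S \<inter> T"
  have X: "finite X" "X \<noteq> {}" using S(2) assms(3) by (auto simp: X_def)
  have aS: "a t = cyc_succ S t" and aT: "a t = cyc_pred T t" and aX: "a t \<in> X" if "t \<in> X" for t
  proof -
    show "a t = cyc_succ S t" "a t = cyc_pred T t"
      using that S(4)[of t] T(4)[of t] by (auto simp: X_def cyc_step_def)
    then show "a t \<in> X"
      using cyc_succ_mem[OF S(2,3), of t] cyc_pred_mem[OF T(2,3), of t] by (simp add: X_def)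
  qed
  define l u where "l = Min X" and "u = Max X"
  have lX: "l \<in> X" and uX: "u \<in> X" using X by (auto simp: l_def u_def)
  have "a u \<le> u" using aX[OF uX] X by (simp add: u_def)
  then have au: "a u = Min S" and Su: "\<And>s. s \<in> S \<Longrightarrow> s \<le> u"
    using cyc_succ_le[OF S(2), of u] aS[OF uX] by auto
  have "l \<le> a l" using aX[OF lX] X by (simp add: l_def)
  then have al: "a l = Max T" and Tl: "\<And>s. s \<in> T \<Longrightarrow> l \<le> s"
    using cyc_pred_ge[OF T(2), of l] aT[OF lX] by auto
  have Sl: "l \<le> s" if "s \<in> S" for s
    using Min_le[OF X(1) aX[OF uX]] Min_le[OF S(2) that] au by (simp add: l_def)
  have Tu: "s \<le> u" if "s \<in> T" for s
    using Max_ge[OF X(1) aX[OF lX]] Max_ge[OF T(2) that] al by (simp add: u_def)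
  have "a u = l" using au Sl lX S(2,3) by (auto simp: X_def intro!: Min_eqI)
  have "a l = u" using al Tu uX T(2,3) by (auto simp: X_def intro!: Max_eqI)
  have "l < u"
  proof (rule ccontr)
    assume "\<not> l < u"
    then have "T \<subseteq> {l}" using Tu Tl by (metis insertCI le_antisym le_trans linorder_not_less subsetI)
    then show False using T(5) card_mono[of "{l}" T] by simp
  qed
  have "S \<subseteq> {l, u}"
  proof
    fix s assume s: "s \<in> S"
    show "s \<in> {l, u}"
      using cyc_succ_least(2)[OF S(2) s, of l] aS[OF lX] \<open>a l = u\<close> Sl[OF s] Su[OF s] by force
  qed
  moreover have "T \<subseteq> {l, u}"
  proof
    fix s assume s: "s \<in> T"
    show "s \<in> {l, u}"
      using cyc_pred_greatest(2)[OF T(2) s, of u] aT[OF uX] \<open>a u = l\<close> Tl[OF s] Tu[OF s] by force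
  qed
  ultimately have "S = {l, u}" "T = {l, u}" using lX uX by (auto simp: X_def)
  then show ?thesis using \<open>l < u\<close> by simp
qed

lemma compatible_realised: "compatible (realised n a)"
  unfolding compatible_def
proof (intro ballI impI)
  fix f g assume f: "f \<in> realised n a" and g: "g \<in> realised n a" and ne: "f \<noteq> g"
  obtain S d T e where fg: "f = (S, d)" "g = (T, e)" by fastforce
  have "fst f = fst g \<and> card (fst f) = 2" if meet: "fst f \<inter> fst g \<noteq> {}"
  proof -
    obtain s where s: "s \<in> S" "s \<in> T" using meet fg by auto
    have "d \<noteq> e"
    proof
      assume "d = e"
      then have "S = T" using realised_overlap_same[of S d n a T s] f g fg s by simp
      then show False using \<open>d = e\<close> fg ne by simp
    qed
    then show ?thesis
      using realised_overlap_opposite[of S n a T] realised_overlap_opposite[of T n a S] f g fg s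
      by (cases d; cases e) auto
  qed
  then show "fst f \<inter> fst g = {} \<or> fst f = fst g \<and> card (fst f) = 2" by blast
qed

text \<open>
  On a two-element set both directions prescribe the same exchange, but (next lemma) the two items are
  always at different positions. So a doubly marked pair forbids two values at each time outside it.
\<close>

lemma cyc_pair_in:
  assumes "card S = 2" "t \<in> S"
  shows "cyc_succ S t = cyc_pred S t"
proof -
  obtain x y where "S = {x, y}" "x \<noteq> y" using assms(1) by (meson card_2_iff)
  then obtain i j where S: "S = {i, j}" and ij: "i < j" by (metis insert_commute linorder_neqE_nat)
  have "cyc_succ {i, j} i = j" "cyc_pred {i, j} j = i"
    using cyc_succ_least[of "{i, j}" j i] cyc_pred_greatest[of "{i, j}" i j]
      cyc_succ_mem[of "{i, j}" i] cyc_pred_mem[of "{i, j}" j] ij by auto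
  moreover have "cyc_succ {i, j} j \<noteq> j" "cyc_pred {i, j} i \<noteq> i"
    using cyc_succ_le(1)[of "{i, j}" j] cyc_pred_ge(1)[of "{i, j}" i] ij by auto
  then have "cyc_succ {i, j} j = i" "cyc_pred {i, j} i = j"
    using cyc_succ_mem[of "{i, j}" j] cyc_pred_mem[of "{i, j}" i] by auto
  ultimately show ?thesis using assms(2) unfolding S by auto
qed

lemma cyc_pair_out:
  assumes "card S = 2" "t \<notin> S"
  shows "cyc_succ S t \<noteq> cyc_pred S t"
proof -
  have fin: "finite S" using assms(1) card.infinite by fastforce
  have ne: "S \<noteq> {}" using assms(1) by auto
  show ?thesis
  proof
    assume eq: "cyc_succ S t = cyc_pred S t"
    have "cyc_succ S t \<noteq> t" using cyc_succ_mem[OF fin ne, of t] assms(2) by metis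
    then consider "cyc_succ S t < t" | "t < cyc_pred S t" using eq by linarith
    then have "Min S = Max S"
    proof cases
      case 1
      then have *: "cyc_succ S t = Min S" and le: "\<And>s. s \<in> S \<Longrightarrow> s \<le> t"
        using cyc_succ_le[OF fin, of t] by auto
      have "Max S < t" using le Max_in[OF fin ne] assms(2) by (metis le_neq_implies_less)
      then have "Max S \<le> cyc_pred S t" using cyc_pred_greatest[OF fin, of "Max S" t] fin ne by simp
      then show ?thesis using * eq fin ne by (simp add: antisym)
    next
      case 2
      then have *: "cyc_pred S t = Max S" and ge: "\<And>s. s \<in> S \<Longrightarrow> t \<le> s"
        using cyc_pred_ge[OF fin, of t] by auto
      have "t < Min S" using ge Min_in[OF fin ne] assms(2) by (metis le_neq_implies_less)
      then have "cyc_succ S t \<le> Min S" using cyc_succ_least[OF fin, of "Min S" t] fin ne by simp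
      then show ?thesis using * eq fin ne by (simp add: antisym)
    qed
    then have "s = Min S" if "s \<in> S" for s
      using Max_ge[OF fin that] Min_le[OF fin that] by simp
    then have "S \<subseteq> {Min S}" by blast
    then show False using card_mono[of "{Min S}" S] assms(1) by simp
  qed
qed

text \<open>
  At a covered time the value is prescribed, and the other marks agree with it: their sets are disjoint
  from the prescribed value or form the same pair. At any other time the marked items are at \<open>card F\<close>
  different positions, all of which must be missed.
\<close>

lemma card_allowed_values:
  assumes F: "F \<subseteq> marks {1..n}" "compatible F" and t: "t \<in> {1..n}"
  shows "card {v \<in> {1..n}. \<forall>f\<in>F. v = cyc_step (snd f) (fst f) t \<longleftrightarrow> t \<in> fst f} =
           (if t \<in> covered F then 1 else n - card F)" (is "card ?V = _")
proof -
  let ?h = "\<lambda>f. cyc_step (snd f) (fst f) t"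
  have mem: "?h f \<in> fst f" "fst f \<subseteq> {1..n}" if "f \<in> F" for f
  proof -
    have "(fst f, snd f) \<in> marks {1..n}" using that F(1) by auto
    then show "?h f \<in> fst f" "fst f \<subseteq> {1..n}"
      using marks_finite[of "fst f" "snd f" "{1..n}"] cyc_step_mem[of "fst f" "snd f" t]
      by (auto simp: marks_def)
  qed
  have meet: "fst f \<inter> fst g = {} \<or> fst g = fst f \<and> card (fst f) = 2 \<and> snd f \<noteq> snd g"
    if "f \<in> F" "g \<in> F" "f \<noteq> g" for f g
    using F(2)[unfolded compatible_def, rule_format, OF that] that(3) prod_eq_iff[of f g] by metis
  show ?thesis
  proof (cases "t \<in> covered F")
    case True
    then obtain f where f: "f \<in> F" "t \<in> fst f" by (auto simp: covered_def)
    have key: "?h f = ?h g \<longleftrightarrow> t \<in> fst g" if g: "g \<in> F" for g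
    proof (cases "f = g")
      case False
      from meet[OF f(1) g False] show ?thesis
      proof (elim disjE conjE)
        assume "fst f \<inter> fst g = {}"
        then have "t \<notin> fst g" "?h f \<noteq> ?h g" using f(2) mem(1)[OF f(1)] mem(1)[OF g] by auto
        then show ?thesis by simp
      next
        assume "fst g = fst f" "card (fst f) = 2"
        then show ?thesis
          using cyc_pair_in[of "fst f" t] f(2) by (simp add: cyc_step_def)
      qed
    qed (use f in simp)
    have "?V = {?h f}"
    proof (intro set_eqI iffI)
      fix v assume "v \<in> ?V"
      then show "v \<in> {?h f}" using f by blast
    next
      fix v assume "v \<in> {?h f}"
      moreover have "?h f \<in> {1..n}" using mem[OF f(1)] by blast
      ultimately show "v \<in> ?V" using key by simp
    qed
    then have "card ?V = 1" by (simp only:) simp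
    then show ?thesis using True by simp
  next
    case False
    then have out: "t \<notin> fst f" if "f \<in> F" for f using that by (auto simp: covered_def)
    have "inj_on ?h F"
    proof (rule inj_onI, rule ccontr)
      fix f g assume fg: "f \<in> F" "g \<in> F" and eq: "?h f = ?h g" and "f \<noteq> g"
      from meet[OF fg this(4)] show False
      proof (elim disjE conjE)
        assume "fst f \<inter> fst g = {}"
        then show False using mem(1)[OF fg(1)] mem(1)[OF fg(2)] eq by auto
      next
        assume "fst g = fst f" "card (fst f) = 2" "snd f \<noteq> snd g"
        then show False
          using cyc_pair_out[of "fst f" t] out[OF fg(1)] eq
          by (cases "snd f") (simp_all add: cyc_step_def)
      qed
    qed
    then have c: "card (?h ` F) = card F" by (rule card_image)
    have sub: "?h ` F \<subseteq> {1..n}" using mem by blast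
    have "?V = {1..n} - ?h ` F" using out by blast
    also have "card \<dots> = n - card F"
      using c sub by (simp add: card_Diff_subset finite_subset[OF sub])
    finally show ?thesis using False by simp
  qed
qed

lemma card_choices_realising:
  assumes F: "F \<subseteq> marks {1..n}"
  shows "card {a \<in> PiE_dflt {1..n} 0 (\<lambda>_. {1..n}). F \<subseteq> realised n a} =
    (if compatible F then (n - card F) ^ (n - card (covered F)) else 0)"
proof (cases "compatible F")
  case False
  then have "{a \<in> PiE_dflt {1..n} 0 (\<lambda>_. {1..n}). F \<subseteq> realised n a} = {}"
    using compatible_subset[OF compatible_realised] by blast
  then show ?thesis using False by (simp only: card.empty if_False)
next
  case True
  let ?V = "\<lambda>t. {v \<in> {1..n}. \<forall>f\<in>F. v = cyc_step (snd f) (fst f) t \<longleftrightarrow> t \<in> fst f}"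
  have U: "covered F \<subseteq> {1..n}" using F by (fastforce simp: covered_def marks_def)
  have "F \<subseteq> realised n a \<longleftrightarrow>
      (\<forall>t\<in>{1..n}. \<forall>f\<in>F. a t = cyc_step (snd f) (fst f) t \<longleftrightarrow> t \<in> fst f)" for a
    using F unfolding realised_def subset_iff mem_Collect_eq case_prod_beta prod.collapse by blast
  then have "{a \<in> PiE_dflt {1..n} 0 (\<lambda>_. {1..n}). F \<subseteq> realised n a} = PiE_dflt {1..n} 0 ?V"
    unfolding PiE_dflt_def by blast
  then have "card {a \<in> PiE_dflt {1..n} 0 (\<lambda>_. {1..n}). F \<subseteq> realised n a} =
      (\<Prod>t\<in>{1..n}. card (?V t))"
    by (simp only:) (rule card_PiE_dflt, auto)
  also have "\<dots> = (\<Prod>t\<in>{1..n}. if t \<in> covered F then 1 else n - card F)"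
    by (intro prod.cong refl card_allowed_values[OF F True])
  also have "\<dots> = (\<Prod>t\<in>{1..n} - covered F. n - card F)"
    by (rule prod.mono_neutral_cong_right) auto
  also have "\<dots> = (n - card F) ^ (n - card (covered F))"
    using U by (simp add: card_Diff_subset finite_subset)
  finally show ?thesis using True by simp
qed

section \<open>Counting compatible sets of marks\<close>

definition configurations :: "nat set \<Rightarrow> nat \<Rightarrow> (nat set \<times> bool) set set" where
  "configurations U r = {F. F \<subseteq> marks U \<and> card F = r \<and> compatible F}"

text \<open>
  The number of marks on a set of \<open>k\<close> elements, divided by \<open>k!\<close>.
\<close>

definition block_weight :: "nat \<Rightarrow> real" where
  "block_weight k = (if k = 0 then 0 else if k = 1 then 1 else 2 / fact k)"

text \<open>
  The coefficient of \<open>v ^ r * z ^ L\<close> in \<open>exp (v * W + v\<^sup>2 * z\<^sup>2 / 2)\<close>, where \<open>W\<close> is the power series in \<open>z\<close> with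
  coefficients \<open>block_weight\<close>. The recursion is the one obtained by differentiating with respect to \<open>v\<close>.
\<close>

fun config_coeff :: "nat \<Rightarrow> nat \<Rightarrow> real" where
  "config_coeff 0 L = (if L = 0 then 1 else 0)"
| "config_coeff (Suc r) L =
     ((\<Sum>k\<le>L. block_weight k * config_coeff r (L - k)) +
      (if 1 \<le> r \<and> 2 \<le> L then config_coeff (r - 1) (L - 2) else 0)) / real (Suc r)"

definition falling_fact :: "nat \<Rightarrow> nat \<Rightarrow> real" where
  "falling_fact m L = fact L * real (m choose L)"

lemma falling_fact_add:
  assumes "k + L \<le> m"
  shows "fact k * real (m choose k) * falling_fact (m - k) L = falling_fact m (k + L)"
  using assms by (simp add: falling_fact_def binomial_fact field_simps)

lemma finite_marks: "finite U \<Longrightarrow> finite (marks U)"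
  by (rule finite_subset[of _ "Pow U \<times> UNIV"]) (auto simp: marks_def)

lemma finite_configurations: "finite U \<Longrightarrow> finite (configurations U r)"
  by (rule finite_subset[of _ "Pow (marks U)"]) (auto simp: configurations_def finite_marks)

lemma sum_Pow_card:
  fixes \<psi> :: "nat \<Rightarrow> real"
  assumes "finite U"
  shows "(\<Sum>S\<in>Pow U. \<psi> (card S)) = (\<Sum>k\<le>card U. real (card U choose k) * \<psi> k)"
proof -
  have "(\<Sum>S\<in>Pow U. \<psi> (card S)) = (\<Sum>k\<le>card U. \<Sum>S\<in>{S \<in> Pow U. card S = k}. \<psi> (card S))"
    using assms by (intro sum.group[symmetric]) (auto intro: card_mono)
  also have "\<dots> = (\<Sum>k\<le>card U. real (card {S. S \<subseteq> U \<and> card S = k}) * \<psi> k)"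
    by (intro sum.cong refl) simp
  finally show ?thesis using assms by (simp add: n_subsets)
qed

lemma sum_marks_card:
  fixes \<psi> :: "nat \<Rightarrow> real"
  assumes U: "finite U"
  shows "(\<Sum>f\<in>marks U. \<psi> (card (fst f))) =
    (\<Sum>k\<le>card U. real (card U choose k) * (fact k * block_weight k * \<psi> k))"
proof -
  let ?D = "\<lambda>S. {d. S \<noteq> {} \<and> (d \<or> 2 \<le> card S)}"
  have D: "real (card (?D S)) = fact (card S) * block_weight (card S)" if "S \<in> Pow U" for S
  proof -
    have "finite S" using that U finite_subset by auto
    then consider "S = {}" | "card S = 1" "S \<noteq> {}" | "2 \<le> card S" "S \<noteq> {}"
      by (metis One_nat_def Suc_leI card_0_eq card_gt_0_iff le_neq_implies_less numeral_2_eq_2)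
    then show ?thesis
    proof cases
      case 2
      then have "?D S = {True}" by auto
      then show ?thesis using 2 by (simp add: block_weight_def)
    next
      case 3
      then have "?D S = UNIV" by auto
      then show ?thesis using 3 by (simp add: block_weight_def card_UNIV_bool)
    qed (simp add: block_weight_def)
  qed
  have "marks U = Sigma (Pow U) ?D" by (auto simp: marks_def)
  then have "(\<Sum>f\<in>marks U. \<psi> (card (fst f))) = (\<Sum>(S, d)\<in>Sigma (Pow U) ?D. \<psi> (card S))"
    by (simp add: case_prod_beta)
  also have "\<dots> = (\<Sum>S\<in>Pow U. \<Sum>d\<in>?D S. \<psi> (card S))"
    using U by (intro sum.Sigma[symmetric]) auto
  also have "\<dots> = (\<Sum>S\<in>Pow U. fact (card S) * block_weight (card S) * \<psi> (card S))"
    by (intro sum.cong refl) (simp add: D)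
  also have "\<dots> = (\<Sum>k\<le>card U. real (card U choose k) * (fact k * block_weight k * \<psi> k))"
    by (rule sum_Pow_card[OF U, of "\<lambda>k. fact k * block_weight k * \<psi> k"])
  finally show ?thesis .
qed

lemma covered_subset: "finite U \<Longrightarrow> F \<subseteq> marks U \<Longrightarrow> covered F \<subseteq> U \<and> finite (covered F)"
proof -
  assume U: "finite U" and F: "F \<subseteq> marks U"
  have "covered F \<subseteq> U" using F by (fastforce simp: covered_def marks_def)
  then show ?thesis using U finite_subset by blast
qed

lemma mark_outside:
  assumes "F \<subseteq> marks (U - S)" "g \<in> F" "S \<noteq> {}" 
  shows "fst g \<inter> S = {}" "fst g \<noteq> S" "g \<in> marks U"
proof -
  have "(fst g, snd g) \<in> marks (U - S)" using assms by auto
  then have "fst g \<subseteq> U - S" "fst g \<noteq> {}" "(fst g, snd g) \<in> marks U" by (auto simp: marks_def)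
  then show "fst g \<inter> S = {}" "fst g \<noteq> S" "g \<in> marks U" by auto
qed

text \<open>
  Removing a mark that is alone on its set leaves a configuration on the complement of the set.
\<close>

lemma sum_configurations_single:
  fixes \<phi> :: "nat \<Rightarrow> real"
  assumes U: "finite U" and f: "(S, d) \<in> marks U"
  shows "(\<Sum>F | F \<in> configurations U (Suc r) \<and> (S, d) \<in> F \<and> (S, \<not> d) \<notin> F. \<phi> (card (covered F)))
       = (\<Sum>F\<in>configurations (U - S) r. \<phi> (card S + card (covered F)))"
proof (rule sum.reindex_bij_witness[where i = "insert (S, d)" and j = "\<lambda>F. F - {(S, d)}"])
  have S: "S \<subseteq> U" "S \<noteq> {}" using f by (auto simp: marks_def)
  have fin: "finite F" if "F \<subseteq> marks V" "V \<subseteq> U" for F V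
    using that finite_marks finite_subset U by metis
  fix F assume F: "F \<in> {F. F \<in> configurations U (Suc r) \<and> (S, d) \<in> F \<and> (S, \<not> d) \<notin> F}"
  then have F': "F \<subseteq> marks U" "card F = Suc r" "compatible F" "(S, d) \<in> F" "(S, \<not> d) \<notin> F"
    by (auto simp: configurations_def)
  have disj: "fst g \<inter> S = {}" if "g \<in> F - {(S, d)}" for g
    using compatibleD[OF F'(3,4), of "fst g" "snd g"] that F'(5) by (cases g) auto
  show "insert (S, d) (F - {(S, d)}) = F" using F'(4) by blast
  have sub: "F - {(S, d)} \<subseteq> marks (U - S)"
    using F'(1) disj by (fastforce simp: marks_def)
  then show "F - {(S, d)} \<in> configurations (U - S) r"
    using F' compatible_subset[OF F'(3), of "F - {(S, d)}"] by (simp add: configurations_def)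
  have "covered F = S \<union> covered (F - {(S, d)})" "S \<inter> covered (F - {(S, d)}) = {}"
    using F'(4) disj by (auto simp: covered_def)
  then show "\<phi> (card S + card (covered (F - {(S, d)}))) = \<phi> (card (covered F))"
    using covered_subset[OF _ sub] U S(1) finite_subset[OF S(1) U] by (simp add: card_Un_disjoint)
next
  have S: "S \<subseteq> U" "S \<noteq> {}" using f by (auto simp: marks_def)
  fix F assume "F \<in> configurations (U - S) r"
  then have F: "F \<subseteq> marks (U - S)" "card F = r" "compatible F" by (auto simp: configurations_def)
  note out = mark_outside[OF F(1) _ S(2)]
  have nin: "(S, e) \<notin> F" for e using out(2)[of "(S, e)"] by auto
  show "insert (S, d) F - {(S, d)} = F" using nin by blast
  have "compatible (insert (S, d) F)"
    using F(3) out(1) unfolding compatible_def by (auto simp: Int_commute)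
  moreover have "finite F" using F(1) finite_marks[of "U - S"] U finite_subset by auto
  moreover have "insert (S, d) F \<subseteq> marks U" using f out(3) by blast
  ultimately show "insert (S, d) F \<in> {F. F \<in> configurations U (Suc r) \<and> (S, d) \<in> F \<and> (S, \<not> d) \<notin> F}"
    using F nin by (auto simp: configurations_def)
qed

text \<open>
  Removing both marks of a doubly marked pair leaves a configuration on the complement of the pair.
\<close>

lemma sum_configurations_double:
  fixes \<phi> :: "nat \<Rightarrow> real"
  assumes U: "finite U" and f: "(S, d) \<in> marks U" and S2: "card S = 2"
  shows "(\<Sum>F | F \<in> configurations U (Suc (Suc r)) \<and> (S, d) \<in> F \<and> (S, \<not> d) \<in> F. \<phi> (card (covered F)))
       = (\<Sum>F\<in>configurations (U - S) r. \<phi> (2 + card (covered F)))"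
proof (rule sum.reindex_bij_witness[where i = "\<lambda>F. {(S, d), (S, \<not> d)} \<union> F"
      and j = "\<lambda>F. F - {(S, d), (S, \<not> d)}"])
  have S: "S \<subseteq> U" "S \<noteq> {}" using f by (auto simp: marks_def)
  fix F assume F: "F \<in> {F. F \<in> configurations U (Suc (Suc r)) \<and> (S, d) \<in> F \<and> (S, \<not> d) \<in> F}"
  then have F': "F \<subseteq> marks U" "card F = Suc (Suc r)" "compatible F" "(S, d) \<in> F" "(S, \<not> d) \<in> F"
    by (auto simp: configurations_def)
  have disj: "fst g \<inter> S = {}" if "g \<in> F - {(S, d), (S, \<not> d)}" for g
    using compatibleD[OF F'(3,4), of "fst g" "snd g"] that by (cases g) auto
  show "{(S, d), (S, \<not> d)} \<union> (F - {(S, d), (S, \<not> d)}) = F" using F'(4,5) by blast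
  have sub: "F - {(S, d), (S, \<not> d)} \<subseteq> marks (U - S)"
    using F'(1) disj by (fastforce simp: marks_def)
  have "card (F - {(S, d), (S, \<not> d)}) = card F - card {(S, d), (S, \<not> d)}"
    using F'(4,5) by (intro card_Diff_subset) auto
  then show "F - {(S, d), (S, \<not> d)} \<in> configurations (U - S) r"
    using sub F'(2) compatible_subset[OF F'(3), of "F - {(S, d), (S, \<not> d)}"]
    by (simp add: configurations_def)
  have "covered F = S \<union> covered (F - {(S, d), (S, \<not> d)})"
    "S \<inter> covered (F - {(S, d), (S, \<not> d)}) = {}"
    using F'(4) disj by (auto simp: covered_def)
  then show "\<phi> (2 + card (covered (F - {(S, d), (S, \<not> d)}))) = \<phi> (card (covered F))"
    using covered_subset[OF _ sub] U S(1) finite_subset[OF S(1) U] S2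
    by (simp add: card_Un_disjoint)
next
  have S: "S \<subseteq> U" "S \<noteq> {}" using f by (auto simp: marks_def)
  fix F assume "F \<in> configurations (U - S) r"
  then have F: "F \<subseteq> marks (U - S)" "card F = r" "compatible F" by (auto simp: configurations_def)
  note out = mark_outside[OF F(1) _ S(2)]
  have nin: "(S, e) \<notin> F" for e using out(2)[of "(S, e)"] by auto
  show "{(S, d), (S, \<not> d)} \<union> F - {(S, d), (S, \<not> d)} = F" using nin by blast
  have "compatible ({(S, d), (S, \<not> d)} \<union> F)"
    using F(3) out(1) S2 unfolding compatible_def by (auto simp: Int_commute)
  moreover have "finite F" using F(1) finite_marks[of "U - S"] U finite_subset by auto
  moreover have "(S, \<not> d) \<in> marks U" using f S2 by (auto simp: marks_def)
  then have "{(S, d), (S, \<not> d)} \<union> F \<subseteq> marks U" using f out(3) by blast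
  ultimately show "{(S, d), (S, \<not> d)} \<union> F
      \<in> {F. F \<in> configurations U (Suc (Suc r)) \<and> (S, d) \<in> F \<and> (S, \<not> d) \<in> F}"
    using F nin by (auto simp: configurations_def)
qed

lemma sum_configurations_containing:
  fixes \<phi> :: "nat \<Rightarrow> real"
  assumes U: "finite U" and f: "(S, d) \<in> marks U"
  shows "(\<Sum>F | F \<in> configurations U (Suc r) \<and> (S, d) \<in> F. \<phi> (card (covered F)))
       = (\<Sum>F\<in>configurations (U - S) r. \<phi> (card S + card (covered F))) +
         (if 1 \<le> r \<and> card S = 2
          then \<Sum>F\<in>configurations (U - S) (r - 1). \<phi> (2 + card (covered F)) else 0)"
proof -
  let ?\<phi> = "\<lambda>F. \<phi> (card (covered F))"
  let ?A = "{F. F \<in> configurations U (Suc r) \<and> (S, d) \<in> F \<and> (S, \<not> d) \<notin> F}"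
  let ?B = "{F. F \<in> configurations U (Suc r) \<and> (S, d) \<in> F \<and> (S, \<not> d) \<in> F}"
  have "{F. F \<in> configurations U (Suc r) \<and> (S, d) \<in> F} = ?A \<union> ?B" by blast
  moreover have "sum ?\<phi> (?A \<union> ?B) = sum ?\<phi> ?A + sum ?\<phi> ?B"
    using finite_configurations[OF U, of "Suc r"] by (intro sum.union_disjoint) auto
  moreover have "sum ?\<phi> ?B = (if 1 \<le> r \<and> card S = 2
          then \<Sum>F\<in>configurations (U - S) (r - 1). \<phi> (2 + card (covered F)) else 0)"
  proof (cases "1 \<le> r \<and> card S = 2")
    case True
    then obtain q where "r = Suc q" by (cases r) auto
    then show ?thesis using True sum_configurations_double[OF U f, of \<phi> q] by simp
  next
    case False
    have "?B = {}"
    proof (rule equals0I)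
      fix F assume "F \<in> ?B"
      then have F: "F \<subseteq> marks U" "card F = Suc r" "compatible F" "(S, d) \<in> F" "(S, \<not> d) \<in> F"
        by (auto simp: configurations_def)
      have "finite F" using F(1) finite_marks[OF U] finite_subset by blast
      then have "card {(S, d), (S, \<not> d)} \<le> card F" using F by (intro card_mono) auto
      moreover have "card S = 2"
        using compatibleD[OF F(3-5)] f by (auto simp: marks_def)
      ultimately show False using False F(2) by simp
    qed
    then show ?thesis using False by (simp only: sum.empty if_False)
  qed
  ultimately show ?thesis using sum_configurations_single[OF U f, of \<phi> r] by simp
qed

text \<open>
  The proof counts configurations with one distinguished mark. This gives the factor \<open>r\<close> on the left,
  and removing the distinguished mark, with its partner if there is one, gives the recursion of \<open>config_coeff\<close>.
  The function \<open>\<phi>\<close> must be arbitrary, because the induction hypothesis is applied to its shifts.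
\<close>

lemma sum_configurations:
  fixes \<phi> :: "nat \<Rightarrow> real"
  assumes "finite U"
  shows "(\<Sum>F\<in>configurations U r. \<phi> (card (covered F))) =
    (\<Sum>L\<le>card U. config_coeff r L * falling_fact (card U) L * \<phi> L)"
  using assms
proof (induction r arbitrary: U \<phi> rule: less_induct)
  case (less r)
  note U = less.prems
  show ?case
  proof (cases r)
    case 0
    have "configurations U 0 = {{}}"
      using finite_subset[OF _ finite_marks[OF U]]
      by (auto simp: configurations_def compatible_def)
    moreover have "(\<Sum>L\<le>card U. config_coeff 0 L * falling_fact (card U) L * \<phi> L) =
        (\<Sum>L\<in>{0}. config_coeff 0 L * falling_fact (card U) L * \<phi> L)"
      by (rule sum.mono_neutral_right) auto
    ultimately show ?thesis by (simp add: 0 covered_def falling_fact_def)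
  next
    case (Suc q)
    define m where "m = card U"
    define \<psi> where "\<psi> k = (\<Sum>L\<le>m - k. config_coeff q L * falling_fact (m - k) L * \<phi> (k + L))" for k
    define D where "D = (\<Sum>L\<le>m - 2. config_coeff (q - 1) L * falling_fact (m - 2) L * \<phi> (2 + L))"
    have containing: "(\<Sum>F | F \<in> configurations U r \<and> f \<in> F. \<phi> (card (covered F))) =
        \<psi> (card (fst f)) + (if 1 \<le> q \<and> card (fst f) = 2 then D else 0)" if "f \<in> marks U" for f
    proof -
      obtain S d where f: "f = (S, d)" by fastforce
      have c: "card (U - S) = m - card S" and fin: "finite (U - S)"
        using that U f by (auto simp: m_def marks_def intro!: card_Diff_subset finite_subset[of S U])
      have "(\<Sum>F\<in>configurations (U - S) q. \<phi> (card S + card (covered F))) = \<psi> (card S)"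
        using less.IH[OF _ fin, of q "\<lambda>L. \<phi> (card S + L)"] by (simp add: Suc c \<psi>_def)
      moreover have "(\<Sum>F\<in>configurations (U - S) (q - 1). \<phi> (2 + card (covered F))) = D"
        if "card S = 2"
        using less.IH[OF _ fin, of "q - 1" "\<lambda>L. \<phi> (2 + L)"] that by (simp add: Suc c D_def)
      ultimately show ?thesis
        using sum_configurations_containing[OF U, of S d \<phi> q] that f Suc by simp
    qed
    have "real r * (\<Sum>F\<in>configurations U r. \<phi> (card (covered F))) =
        (\<Sum>F\<in>configurations U r. \<Sum>f\<in>F. \<phi> (card (covered F)))"
      by (simp add: sum_distrib_left configurations_def)
    also have "\<dots> = (\<Sum>F\<in>configurations U r. \<Sum>f | f \<in> marks U \<and> f \<in> F. \<phi> (card (covered F)))"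
      by (intro sum.cong refl) (auto simp: configurations_def)
    also have "\<dots> = (\<Sum>f\<in>marks U. \<Sum>F | F \<in> configurations U r \<and> f \<in> F. \<phi> (card (covered F)))"
      by (rule sum.swap_restrict[OF finite_configurations[OF U] finite_marks[OF U]])
    also have "\<dots> = (\<Sum>f\<in>marks U. \<psi> (card (fst f)) + (if 1 \<le> q \<and> card (fst f) = 2 then D else 0))"
      by (intro sum.cong refl containing)
    also have "\<dots> = (\<Sum>k\<le>m. real (m choose k) *
        (fact k * block_weight k * (\<psi> k + (if 1 \<le> q \<and> k = 2 then D else 0))))"
      unfolding m_def
      by (rule sum_marks_card[OF U, of "\<lambda>k. \<psi> k + (if 1 \<le> q \<and> k = 2 then D else 0)"])
    also have "\<dots> = (\<Sum>k\<le>m. fact k * real (m choose k) * block_weight k * \<psi> k) +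
        (\<Sum>k\<le>m. if k = 2 then (if 1 \<le> q then 2 * real (m choose 2) * D else 0) else 0)"
      unfolding sum.distrib[symmetric]
      by (intro sum.cong refl) (auto simp: algebra_simps block_weight_def)
    also have "(\<Sum>k\<le>m. fact k * real (m choose k) * block_weight k * \<psi> k) =
        (\<Sum>k\<le>m. \<Sum>L\<le>m - k. block_weight k * config_coeff q L * falling_fact m (k + L) * \<phi> (k + L))"
      unfolding \<psi>_def sum_distrib_left
      by (intro sum.cong refl) (simp add: falling_fact_add[symmetric])
    also have "\<dots> = (\<Sum>(k, L)\<in>{(k, L). k + L \<le> m}.
        block_weight k * config_coeff q L * falling_fact m (k + L) * \<phi> (k + L))"
      by (subst sum.Sigma) (auto intro!: sum.cong)
    also have "\<dots> = (\<Sum>N\<le>m. \<Sum>k\<le>N. block_weight k * config_coeff q (N - k) * falling_fact m N * \<phi> N)"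
      unfolding sum.triangle_reindex_eq by (intro sum.cong refl) simp
    also have "(\<Sum>k\<le>m. if k = 2 then (if 1 \<le> q then 2 * real (m choose 2) * D else 0) else 0) =
        (\<Sum>N\<le>m. (if 1 \<le> q \<and> 2 \<le> N then config_coeff (q - 1) (N - 2) else 0) * falling_fact m N * \<phi> N)"
    proof (cases "1 \<le> q \<and> 2 \<le> m")
      case True
      have [simp]: "Suc (Suc (N - 2)) = N" if "2 \<le> N" for N using that by simp
      have "(\<Sum>N\<le>m. (if 1 \<le> q \<and> 2 \<le> N then config_coeff (q - 1) (N - 2) else 0) * falling_fact m N * \<phi> N)
          = (\<Sum>N\<in>{2..m}. config_coeff (q - 1) (N - 2) * falling_fact m N * \<phi> N)"
        using True by (intro sum.mono_neutral_cong_right) auto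
      also have "\<dots> = (\<Sum>L\<le>m - 2. config_coeff (q - 1) L * falling_fact m (2 + L) * \<phi> (2 + L))"
        using True by (intro sum.reindex_bij_witness[where i = "\<lambda>L. 2 + L" and j = "\<lambda>N. N - 2"]) auto
      also have "\<dots> = 2 * real (m choose 2) * D"
        unfolding D_def sum_distrib_left
      proof (intro sum.cong refl)
        fix L assume "L \<in> {..m - 2}"
        then have "2 + L \<le> m" using True by auto
        then have "falling_fact m (2 + L) = 2 * real (m choose 2) * falling_fact (m - 2) L"
          using falling_fact_add[of 2 L m] by (simp add: fact_2)
        then show "config_coeff (q - 1) L * falling_fact m (2 + L) * \<phi> (2 + L) =
            2 * real (m choose 2) * (config_coeff (q - 1) L * falling_fact (m - 2) L * \<phi> (2 + L))"
          by simp
      qed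
      finally show ?thesis using True by simp
    next
      case False
      then show ?thesis by (auto intro!: sum.neutral[symmetric])
    qed
    finally have "real r * (\<Sum>F\<in>configurations U r. \<phi> (card (covered F))) =
        (\<Sum>N\<le>m. ((\<Sum>k\<le>N. block_weight k * config_coeff q (N - k)) +
           (if 1 \<le> q \<and> 2 \<le> N then config_coeff (q - 1) (N - 2) else 0)) * falling_fact m N * \<phi> N)"
      by (simp only: sum.distrib[symmetric] distrib_right sum_distrib_right)
    also have "\<dots> = real r * (\<Sum>N\<le>m. config_coeff r N * falling_fact m N * \<phi> N)"
      unfolding sum_distrib_left by (intro sum.cong refl) (simp add: Suc)
    finally show ?thesis using Suc by (simp add: m_def)
  qed
qed

section \<open>Limits of the binomial moments\<close>

text \<open>
  The coefficients of \<open>exp ((2 * e - 3) * v + v\<^sup>2 / 2)\<close>, which is the generating function behind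
  \<open>config_coeff\<close> at \<open>z = 1\<close>. They are given by the recursion that the derivative provides.
\<close>

fun config_total :: "nat \<Rightarrow> real" where
  "config_total 0 = 1"
| "config_total (Suc r) =
     ((2 * exp 1 - 3) * config_total r + (if 1 \<le> r then config_total (r - 1) else 0)) / real (Suc r)"

lemma block_weight_nonneg: "0 \<le> block_weight k"
  by (simp add: block_weight_def)

lemma config_coeff_nonneg: "0 \<le> config_coeff r L"
proof (induction r arbitrary: L rule: less_induct)
  case (less r)
  show ?case
  proof (cases r)
    case (Suc q)
    have "0 \<le> (\<Sum>k\<le>L. block_weight k * config_coeff q (L - k))"
      using less[of q] Suc by (intro sum_nonneg mult_nonneg_nonneg block_weight_nonneg) auto
    moreover have "0 \<le> config_coeff (q - 1) (L - 2)" using less[of "q - 1"] Suc by simp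
    ultimately show ?thesis by (simp add: Suc)
  qed simp
qed

lemma block_weight_sums: "block_weight sums (2 * exp 1 - 3)"
proof -
  have "(\<lambda>k. 2 * (1 / fact k :: real)) sums (2 * exp 1)"
    using exp_converges[of "1::real"] by (intro sums_mult) (simp add: divide_inverse)
  moreover have "(\<lambda>k. if k \<in> {0, 1} then 2 / fact k - block_weight k else 0) sums
      (\<Sum>k\<in>{0, 1}. 2 / fact k - block_weight k)"
    by (rule sums_If_finite_set) simp
  ultimately have "(\<lambda>k. 2 * (1 / fact k) - (if k \<in> {0, 1} then 2 / fact k - block_weight k else 0))
      sums (2 * exp 1 - (\<Sum>k\<in>{0, 1}. 2 / fact k - block_weight k))"
    by (rule sums_diff)
  moreover have "(\<lambda>k. 2 * (1 / fact k) - (if k \<in> {0, 1} then 2 / fact k - block_weight k else 0)) =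
      block_weight"
    by (auto simp: block_weight_def fun_eq_iff)
  ultimately show ?thesis by (simp add: block_weight_def)
qed

lemma config_coeff_sums: "config_coeff r sums config_total r"
proof (induction r rule: less_induct)
  case (less r)
  show ?case
  proof (cases r)
    case 0
    then show ?thesis using sums_If_finite_set[of "{0}" "\<lambda>_. 1::real"] by simp
  next
    case (Suc q)
    have q: "config_coeff q sums config_total q" using less Suc by simp
    have "(\<lambda>L. \<Sum>k\<le>L. block_weight k * config_coeff q (L - k)) sums
        ((2 * exp 1 - 3) * config_total q)"
      using Cauchy_product_sums[of block_weight "config_coeff q"] block_weight_sums q
      by (simp add: block_weight_nonneg config_coeff_nonneg sums_iff)
    moreover have "(\<lambda>L. if 1 \<le> q \<and> 2 \<le> L then config_coeff (q - 1) (L - 2) else 0) sums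
        (if 1 \<le> q then config_total (q - 1) else 0)"
    proof (cases "1 \<le> q")
      case True
      then have "config_coeff (q - 1) sums config_total (q - 1)" using less Suc by simp
      then have "(\<lambda>L. (\<lambda>L. if 2 \<le> L then config_coeff (q - 1) (L - 2) else 0) (L + 2))
          sums config_total (q - 1)" by simp
      then have "(\<lambda>L. if 2 \<le> L then config_coeff (q - 1) (L - 2) else 0) sums
          config_total (q - 1)"
        by (subst (asm) sums_iff_shift) (simp add: numeral_2_eq_2)
      then show ?thesis using True by simp
    qed simp
    ultimately have "(\<lambda>L. ((\<Sum>k\<le>L. block_weight k * config_coeff q (L - k)) +
        (if 1 \<le> q \<and> 2 \<le> L then config_coeff (q - 1) (L - 2) else 0)) / real (Suc q)) sums
        (((2 * exp 1 - 3) * config_total q + (if 1 \<le> q then config_total (q - 1) else 0)) / real (Suc q))"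
      by (intro sums_divide sums_add)
    then show ?thesis by (simp add: Suc)
  qed
qed

lemma config_total_nonneg: "0 \<le> config_total r"
  using sums_le[OF config_coeff_nonneg sums_zero config_coeff_sums] .

text \<open>
  The sequences \<open>a\<close> and \<open>b\<close> hold the coefficients of \<open>exp ((2 * e - 3) * v)\<close> and of \<open>exp (v\<^sup>2 / 2)\<close>.
  The recursion of \<open>config_total\<close> is the product rule for the derivative of their product.
\<close>

lemma config_total_convolution:
  defines "a \<equiv> \<lambda>i. (2 * exp 1 - 3) ^ i / fact i :: real"
    and "b \<equiv> \<lambda>j. if even j then (1 / 2) ^ (j div 2) / fact (j div 2) else 0 :: real"
  shows "config_total r = (\<Sum>i\<le>r. a i * b (r - i))"
proof (induction r rule: less_induct)
  case (less r)
  have a_Suc: "real (Suc i) * a (Suc i) = (2 * exp 1 - 3) * a i" for i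
    by (simp add: a_def field_simps del: of_nat_Suc)
  have b_Suc: "real (Suc j) * b (Suc j) = (if 1 \<le> j then b (j - 1) else 0)" for j
  proof (cases "odd j")
    case True
    then obtain h where h: "j = 2 * h + 1" by (elim oddE)
    then have "Suc j = 2 * Suc h" by simp
    then have "b (Suc j) = (1 / 2) * (1 / 2) ^ h / (real (Suc h) * fact h)"
      by (simp add: b_def del: of_nat_Suc)
    moreover have "real (Suc j) = 2 * real (Suc h)" using h by simp
    moreover have "b (j - 1) = (1 / 2) ^ h / fact h" using h by (simp add: b_def)
    ultimately show ?thesis using h by (simp del: of_nat_Suc)
  next
    case False
    then show ?thesis by (auto simp: b_def)
  qed
  show ?case
  proof (cases r)
    case 0
    then show ?thesis by (simp add: a_def b_def)
  next
    case (Suc q)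
    have "real (Suc q) * (\<Sum>i\<le>Suc q. a i * b (Suc q - i)) =
        (\<Sum>i\<le>Suc q. real i * a i * b (Suc q - i)) + (\<Sum>i\<le>Suc q. a i * (real (Suc q - i) * b (Suc q - i)))"
      unfolding sum_distrib_left sum.distrib[symmetric]
      by (intro sum.cong refl) (simp add: of_nat_diff algebra_simps)
    also have "(\<Sum>i\<le>Suc q. real i * a i * b (Suc q - i)) = (2 * exp 1 - 3) * (\<Sum>i\<le>q. a i * b (q - i))"
      unfolding sum.atMost_Suc_shift sum_distrib_left using a_Suc by (simp add: mult.assoc[symmetric] del: of_nat_Suc)
    also have "(\<Sum>i\<le>Suc q. a i * (real (Suc q - i) * b (Suc q - i))) =
        (\<Sum>i\<le>q. a i * (if 1 \<le> q - i then b (q - i - 1) else 0))"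
    proof -
      have "a i * (real (Suc q - i) * b (Suc q - i)) =
          a i * (if 1 \<le> q - i then b (q - i - 1) else 0)" if "i \<le> q" for i
        unfolding Suc_diff_le[OF that] b_Suc ..
      then have "(\<Sum>i\<le>q. a i * (real (Suc q - i) * b (Suc q - i))) =
          (\<Sum>i\<le>q. a i * (if 1 \<le> q - i then b (q - i - 1) else 0))"
        by (intro sum.cong refl) blast
      then show ?thesis by (simp only: sum.atMost_Suc) simp
    qed
    also have "\<dots> = (if 1 \<le> q then \<Sum>i\<le>q - 1. a i * b (q - 1 - i) else 0)"
    proof (cases q)
      case (Suc p)
      then show ?thesis by (auto simp: Suc_diff_le intro!: sum.cong)
    qed simp
    finally show ?thesis
      using less[of q] less[of "q - 1"] Suc by (auto simp: field_simps)
  qed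
qed

lemma config_total_power_series:
  fixes u :: complex
  shows "(\<lambda>r. complex_of_real (config_total r) * u ^ r) sums exp (of_real (2 * exp 1 - 3) * u + u\<^sup>2 / 2)"
proof -
  define a :: "nat \<Rightarrow> real" where "a = (\<lambda>i. (2 * exp 1 - 3) ^ i / fact i)"
  define b :: "nat \<Rightarrow> real" where
    "b = (\<lambda>j. if even j then (1 / 2) ^ (j div 2) / fact (j div 2) else 0)"
  define A where "A i = complex_of_real (a i) * u ^ i" for i
  define B where "B j = complex_of_real (b j) * u ^ j" for j
  let ?\<alpha> = "complex_of_real (2 * exp 1 - 3) * u"
  have A_eq: "A i = ?\<alpha> ^ i /\<^sub>R fact i" for i
    unfolding A_def a_def power_mult_distrib of_real_divide of_real_power of_real_fact
      scaleR_conv_of_real of_real_inverse by (simp add: field_simps)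
  have B_even: "B (2 * j) = (u\<^sup>2 / 2) ^ j /\<^sub>R fact j" for j
    unfolding B_def b_def power_mult power_divide scaleR_conv_of_real of_real_inverse of_real_fact
    by (simp add: field_simps)
  have odd_zero: "n \<notin> range ((*) 2) \<Longrightarrow> B n = 0" for n
  proof -
    assume "n \<notin> range ((*) 2)"
    then have "odd n" by (metis dvd_def rangeI)
    then show "B n = 0" by (simp add: B_def b_def)
  qed
  have mono: "strict_mono ((*) 2 :: nat \<Rightarrow> nat)" by (auto simp: strict_mono_def)
  have A_sums: "(\<lambda>i. A i) sums exp ?\<alpha>" unfolding A_eq by (rule exp_converges)
  have A_abs: "summable (\<lambda>i. norm (A i))" unfolding A_eq by (rule summable_norm_exp)
  have B_sums: "B sums exp (u\<^sup>2 / 2)"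
    using exp_converges[of "u\<^sup>2 / 2"] sums_mono_reindex[OF mono, of B] odd_zero by (simp add: B_even)
  have B_abs: "summable (\<lambda>j. norm (B j))"
    using summable_norm_exp[of "u\<^sup>2 / 2"] summable_mono_reindex[OF mono, of "\<lambda>j. norm (B j)"] odd_zero
    by (simp add: B_even)
  have "(\<Sum>i\<le>r. A i * B (r - i)) = complex_of_real (config_total r) * u ^ r" for r
  proof -
    have term_eq: "A i * B (r - i) = complex_of_real (a i * b (r - i)) * u ^ r" if "i \<le> r" for i
      using that by (simp add: A_def B_def power_add[symmetric])
    have "config_total r = (\<Sum>i\<le>r. a i * b (r - i))"
      unfolding a_def b_def by (rule config_total_convolution)
    then show ?thesis
      by (simp only: of_real_sum sum_distrib_right) (intro sum.cong refl term_eq, simp)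
  qed
  then show ?thesis
    using Cauchy_product_sums[OF A_abs B_abs] A_sums B_sums by (simp add: sums_iff exp_add)
qed

lemma summable_config_total: "summable (\<lambda>r. config_total r * x ^ r)"
proof -
  have "summable (\<lambda>r. complex_of_real (config_total r * x ^ r))"
    using sums_summable[OF config_total_power_series[of "of_real x"]] by simp
  then show ?thesis unfolding summable_complex_of_real .
qed

text \<open>
  The number of ordered choices of \<open>L\<close> positions, times the probability that \<open>r\<close> given compatible marks
  covering \<open>L\<close> positions are realised.
\<close>

definition realisation_weight :: "nat \<Rightarrow> nat \<Rightarrow> nat \<Rightarrow> real" where
  "realisation_weight n r L = falling_fact n L * real ((n - r) ^ (n - L)) / real (n ^ n)"

text \<open>
  This is the average of \<open>X choose r\<close> over all sequences \<open>a\<close>, where \<open>X\<close> is the number of fixed points;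
  see \<open>average_choose_realised\<close>. The explicit form shows the limit.
\<close>

definition binomial_moment :: "nat \<Rightarrow> nat \<Rightarrow> real" where
  "binomial_moment n r = (\<Sum>L\<le>n. config_coeff r L * realisation_weight n r L)"

lemma falling_fact_le_power: "falling_fact n L \<le> real n ^ L"
proof -
  have "real ((n choose L) * fact L) \<le> real (n ^ L)"
    using binomial_fact_pow[of n L] of_nat_le_iff by blast
  then show ?thesis by (simp add: falling_fact_def mult.commute)
qed

lemma falling_fact_Suc: "falling_fact n (Suc L) = falling_fact n L * (real n - real L)"
proof (cases "L < n")
  case True
  then show ?thesis
    using falling_fact_add[of L 1 n] by (simp add: falling_fact_def of_nat_diff)
next
  case False
  then have "L = n \<or> n < L" by linarith
  then show ?thesis by (auto simp: falling_fact_def binomial_eq_0)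
qed

lemma falling_fact_ratio_tendsto: "(\<lambda>n. falling_fact n L / real n ^ L) \<longlonglongrightarrow> 1"
proof (induction L)
  case (Suc L)
  have "(\<lambda>n. falling_fact n L / real n ^ L * (1 - real L / real n)) \<longlonglongrightarrow> 1 * (1 - 0)"
    by (intro tendsto_intros Suc lim_const_over_n)
  moreover have "\<forall>\<^sub>F n in sequentially. falling_fact n L / real n ^ L * (1 - real L / real n) =
      falling_fact n (Suc L) / real n ^ Suc L"
    using eventually_gt_at_top[of 0] by eventually_elim (simp add: falling_fact_Suc field_simps)
  ultimately show ?case by (simp add: tendsto_cong)
qed (simp add: falling_fact_def)

lemma realisation_weight_tendsto: "(\<lambda>n. realisation_weight n r L) \<longlonglongrightarrow> exp (- real r)"
proof -
  have "(\<lambda>n. falling_fact n L / real n ^ L * ((1 + (- real r) / real n) ^ n / (1 - real r / real n) ^ L))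
      \<longlonglongrightarrow> 1 * (exp (- real r) / (1 - 0) ^ L)"
    by (intro tendsto_intros falling_fact_ratio_tendsto tendsto_exp_limit_sequentially lim_const_over_n) simp
  moreover have "\<forall>\<^sub>F n in sequentially.
      falling_fact n L / real n ^ L * ((1 + (- real r) / real n) ^ n / (1 - real r / real n) ^ L) =
      realisation_weight n r L"
    using eventually_gt_at_top[of "max r L"]
  proof eventually_elim
    case (elim n)
    define z where "z = 1 - real r / real n"
    have n: "real n > 0" and z: "z \<noteq> 0" and nr: "real (n - r) = real n * z"
      using elim by (auto simp: z_def of_nat_diff field_simps)
    have split: "x ^ n = x ^ L * x ^ (n - L)" for x :: real
      using elim by (simp flip: power_add)
    have "real ((n - r) ^ (n - L)) / real (n ^ n) = z ^ (n - L) / real n ^ L"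
      unfolding of_nat_power nr power_mult_distrib split[of "real n"] using n by simp
    moreover have "z ^ n / z ^ L = z ^ (n - L)"
      using z split[of z] by simp
    moreover have "1 + (- real r) / real n = z" "1 - real r / real n = z" by (simp_all add: z_def)
    ultimately show ?case
      by (simp add: realisation_weight_def flip: times_divide_eq_right)
  qed
  ultimately show ?thesis by (simp add: tendsto_cong)
qed

lemma realisation_weight_bounds: "0 \<le> realisation_weight n r L" "realisation_weight n r L \<le> 1"
proof -
  show "0 \<le> realisation_weight n r L" by (simp add: realisation_weight_def falling_fact_def)
  show "realisation_weight n r L \<le> 1"
  proof (cases "L \<le> n")
    case True
    have "falling_fact n L * real ((n - r) ^ (n - L)) \<le> real n ^ L * real n ^ (n - L)"
      unfolding of_nat_power
      by (intro mult_mono falling_fact_le_power power_mono) auto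
    also have "\<dots> = real (n ^ n)" using True by (simp flip: power_add)
    finally show ?thesis
      unfolding realisation_weight_def by (intro divide_le_eq_1[THEN iffD2]) auto
  next
    case False
    then show ?thesis by (simp add: realisation_weight_def falling_fact_def binomial_eq_0)
  qed
qed

lemma binomial_moment_suminf:
  "binomial_moment n r = (\<Sum>L. config_coeff r L * realisation_weight n r L)"
  unfolding binomial_moment_def
  by (rule suminf_finite[symmetric]) (auto simp: realisation_weight_def falling_fact_def not_le)

lemma config_coeff_weighted_le:
  "norm (config_coeff r L * realisation_weight n r L) \<le> config_coeff r L"
  using realisation_weight_bounds[of n r L] config_coeff_nonneg[of r L]
  by (simp add: mult_left_le)

text \<open>
  Each term is dominated by \<open>config_coeff r L\<close>, which is summable over \<open>L\<close> and independent of \<open>n\<close>.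
\<close>

lemma binomial_moment_tendsto: "(\<lambda>n. binomial_moment n r) \<longlonglongrightarrow> config_total r * exp (- real r)"
proof -
  have "(\<lambda>n. config_coeff r L * realisation_weight n r L) \<longlonglongrightarrow> config_coeff r L * exp (- real r)" for L
    by (intro tendsto_intros realisation_weight_tendsto)
  moreover have "\<forall>\<^sub>F (L, n) in sequentially \<times>\<^sub>F sequentially.
      norm (config_coeff r L * realisation_weight n r L) \<le> config_coeff r L"
    by (intro always_eventually) (simp add: case_prod_beta config_coeff_weighted_le del: real_norm_def)
  ultimately have "(\<lambda>n. \<Sum>L. config_coeff r L * realisation_weight n r L)
      \<longlonglongrightarrow> (\<Sum>L. config_coeff r L * exp (- real r))"
    by (rule tannerys_theorem[THEN conjunct2, THEN conjunct2])
      (simp_all add: sums_summable[OF config_coeff_sums])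
  moreover have "(\<Sum>L. config_coeff r L * exp (- real r)) = config_total r * exp (- real r)"
    using sums_mult2[OF config_coeff_sums] by (simp add: sums_iff)
  ultimately show ?thesis by (simp add: binomial_moment_suminf)
qed

lemma binomial_moment_bounds: "0 \<le> binomial_moment n r" "binomial_moment n r \<le> config_total r"
proof -
  show "0 \<le> binomial_moment n r"
    by (auto simp: binomial_moment_def intro!: sum_nonneg mult_nonneg_nonneg
        config_coeff_nonneg realisation_weight_bounds)
  have "norm (binomial_moment n r) \<le> (\<Sum>L. config_coeff r L)"
    unfolding binomial_moment_suminf
    by (intro norm_suminf_le config_coeff_weighted_le sums_summable[OF config_coeff_sums])
  then show "binomial_moment n r \<le> config_total r"
    using config_coeff_sums[of r] by (simp add: sums_iff)
qed

section \<open>From binomial moments to the distribution\<close>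

lemma choices_pmf_eq:
  assumes "1 \<le> n"
  shows "choices_pmf n = pmf_of_set (PiE_dflt {1..n} 0 (\<lambda>_. {1..n}))"
  unfolding choices_pmf_def using assms by (intro Pi_pmf_of_set) auto

lemma choices_finite:
  "finite (PiE_dflt {1..n} 0 (\<lambda>_. {1..n::nat}))"
  by (intro finite_PiE_dflt) auto

lemma choices_card: "card (PiE_dflt {1..n} 0 (\<lambda>_. {1..n::nat})) = n ^ n"
  by (subst card_PiE_dflt) auto

lemma choices_nonempty:
  assumes "1 \<le> n"
  shows "PiE_dflt {1..n} 0 (\<lambda>_. {1..n::nat}) \<noteq> {}"
proof
  assume "PiE_dflt {1..n} 0 (\<lambda>_. {1..n}) = {}"
  then show False using choices_card[of n] assms by simp
qed

lemma finite_realised: "finite (realised n a)"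
  by (rule finite_subset[of _ "marks {1..n}"]) (auto simp: realised_def intro: finite_marks)

text \<open>
  Double counting: \<open>X choose r\<close> is the number of \<open>r\<close>-element sets of realised marks, so the sum over \<open>a\<close>
  can be taken one set of marks at a time.
\<close>

lemma average_choose_realised:
  "(\<Sum>a\<in>PiE_dflt {1..n} 0 (\<lambda>_. {1..n}). real (card (realised n a) choose r)) / real (n ^ n) =
     binomial_moment n r"
proof -
  let ?A = "PiE_dflt {1..n} 0 (\<lambda>_. {1..n})"
  let ?M = "{F. F \<subseteq> marks {1..n} \<and> card F = r}"
  have fM: "finite ?M"
    by (rule finite_subset[of _ "Pow (marks {1..n})"]) (auto intro: finite_marks)
  have "(\<Sum>a\<in>?A. real (card (realised n a) choose r)) =
      (\<Sum>a\<in>?A. \<Sum>F | F \<in> ?M \<and> F \<subseteq> realised n a. 1)"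
  proof (intro sum.cong refl)
    fix a
    have "realised n a \<subseteq> marks {1..n}" by (auto simp: realised_def)
    then have "{F. F \<in> ?M \<and> F \<subseteq> realised n a} = {F. F \<subseteq> realised n a \<and> card F = r}"
      by blast
    then show "real (card (realised n a) choose r) = (\<Sum>F | F \<in> ?M \<and> F \<subseteq> realised n a. 1)"
      using n_subsets[OF finite_realised, of n a r] by simp
  qed
  also have "\<dots> = (\<Sum>F\<in>?M. \<Sum>a | a \<in> ?A \<and> F \<subseteq> realised n a. 1)"
    by (rule sum.swap_restrict[OF choices_finite fM])
  also have "\<dots> = (\<Sum>F\<in>?M. if compatible F
      then real ((n - r) ^ (n - card (covered F))) else 0)"
  proof (intro sum.cong refl)
    fix F assume "F \<in> ?M"
    then have "F \<subseteq> marks {1..n}" and r: "card F = r" by blast+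
    from card_choices_realising[OF this(1)]
    show "(\<Sum>a | a \<in> ?A \<and> F \<subseteq> realised n a. 1) =
        (if compatible F then real ((n - r) ^ (n - card (covered F))) else 0)"
      unfolding r sum_constant mult_1_right by (simp only:) simp
  qed
  also have "\<dots> = (\<Sum>F\<in>configurations {1..n} r. real ((n - r) ^ (n - card (covered F))))"
    using fM by (intro sum.mono_neutral_cong_right) (auto simp: configurations_def)
  also have "\<dots> = (\<Sum>L\<le>n. config_coeff r L * falling_fact n L * real ((n - r) ^ (n - L)))"
    using sum_configurations[of "{1..n}" "\<lambda>L. real ((n - r) ^ (n - L))" r] by simp
  finally show ?thesis
    by (simp add: binomial_moment_def realisation_weight_def sum_divide_distrib mult.assoc)
qed

text \<open>
  By \<open>choose_mult\<close> the sum is \<open>X choose k\<close> times an alternating row sum of Pascal's triangle, which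
  vanishes unless \<open>X = k\<close>.
\<close>

lemma binomial_inversion:
  assumes "X \<le> n"
  shows "(\<Sum>r\<le>n. (-1) ^ (r + k) * real (r choose k) * real (X choose r)) = of_bool (X = k)"
proof (cases "k \<le> X")
  case True
  have "(\<Sum>r\<le>n. (-1) ^ (r + k) * real (r choose k) * real (X choose r)) =
      (\<Sum>r\<in>{k..X}. (-1) ^ (r + k) * real (r choose k) * real (X choose r))"
    using assms by (intro sum.mono_neutral_right) (auto simp: binomial_eq_0 not_le)
  also have "\<dots> = (\<Sum>i\<le>X - k. (-1) ^ i * real (X choose k) * real ((X - k) choose i))"
  proof (rule sum.reindex_bij_witness[where i = "\<lambda>i. i + k" and j = "\<lambda>r. r - k"])
    fix r assume r: "r \<in> {k..X}"
    have "(-1) ^ (r + k) = ((-1) ^ (r - k) :: real)"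
      using r by (auto simp: minus_one_power_iff)
    moreover have "real (r choose k) * real (X choose r) = real (X choose k) * real ((X - k) choose (r - k))"
      using choose_mult[of k r X] r by (metis atLeastAtMost_iff mult.commute of_nat_mult)
    ultimately show "(-1) ^ (r - k) * real (X choose k) * real ((X - k) choose (r - k)) =
        (-1) ^ (r + k) * real (r choose k) * real (X choose r)"
      by (simp add: mult.assoc)
  qed (use True in auto)
  also have "\<dots> = real (X choose k) * (\<Sum>i\<le>X - k. (-1) ^ i * real ((X - k) choose i))"
    by (simp add: sum_distrib_left mult_ac)
  also have "\<dots> = of_bool (X = k)"
    using True choose_alternating_sum[of "X - k", where 'a = real] by (cases "X = k") auto
  finally show ?thesis .
next
  case False
  then show ?thesis
    by (intro sum.neutral[THEN trans]) (auto simp: binomial_eq_0 not_le)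
qed

lemma prob_fixed_points_eq:
  assumes n: "1 \<le> n"
  shows "prob_fixed_points n k = (\<Sum>r. (-1) ^ (r + k) * real (r choose k) * binomial_moment n r)"
proof -
  let ?A = "PiE_dflt {1..n} 0 (\<lambda>_. {1..n})"
  let ?X = "\<lambda>a. card (realised n a)"
  have Xn: "?X a \<le> n" for a
  proof -
    have "card (fixed_points n (exchange_shuffle a n)) \<le> card {1..n}"
      by (intro card_mono) (auto simp: fixed_points_def)
    then show ?thesis by (simp add: card_fixed_points)
  qed
  have zero: "binomial_moment n r = 0" if "n < r" for r
  proof -
    have "?X a choose r = 0" for a using Xn[of a] that by (intro binomial_eq_0) simp
    then show ?thesis
      unfolding average_choose_realised[symmetric]
      by (simp only: of_nat_0 sum.neutral_const div_0)
  qed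
  have "prob_fixed_points n k = measure_pmf.prob (pmf_of_set ?A) {a. ?X a = k}"
    by (simp add: prob_fixed_points_def choices_pmf_eq[OF n] card_fixed_points)
  also have "\<dots> = real (card (?A \<inter> {a. ?X a = k})) / real (n ^ n)"
    by (subst measure_pmf_of_set[OF choices_nonempty[OF n] choices_finite]) (simp only: choices_card)
  also have "real (card (?A \<inter> {a. ?X a = k})) = (\<Sum>a\<in>?A. of_bool (?X a = k))"
    using choices_finite[of n] by (simp add: sum.If_cases of_bool_def)
  also have "\<dots> = (\<Sum>a\<in>?A. \<Sum>r\<le>n. (-1) ^ (r + k) * real (r choose k) * real (?X a choose r))"
    by (intro sum.cong refl binomial_inversion[symmetric] Xn)
  also have "\<dots> = (\<Sum>r\<le>n. (-1) ^ (r + k) * real (r choose k) * (\<Sum>a\<in>?A. real (?X a choose r)))"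
    unfolding sum_distrib_left by (rule sum.swap)
  also have "\<dots> / real (n ^ n) =
      (\<Sum>r\<le>n. (-1) ^ (r + k) * real (r choose k) * ((\<Sum>a\<in>?A. real (?X a choose r)) / real (n ^ n)))"
    by (subst sum_divide_distrib) (simp only: times_divide_eq_right)
  also have "\<dots> = (\<Sum>r\<le>n. (-1) ^ (r + k) * real (r choose k) * binomial_moment n r)"
    by (simp only: average_choose_realised)
  also have "\<dots> = (\<Sum>r. (-1) ^ (r + k) * real (r choose k) * binomial_moment n r)"
    by (rule suminf_finite[symmetric]) (auto simp: zero not_le)
  finally show ?thesis .
qed

text \<open>
  Dominated convergence of the inversion formula, with \<open>r choose k \<le> 2 ^ r\<close>.
\<close>

lemma prob_fixed_points_tendsto:
  "(\<lambda>n. prob_fixed_points n k) \<longlonglongrightarrow>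
     (\<Sum>r. (-1) ^ (r + k) * real (r choose k) * (config_total r * exp (- real r)))"
proof -
  have bound: "norm ((-1) ^ (r + k) * real (r choose k) * binomial_moment n r) \<le> config_total r * 2 ^ r"
    for r n
  proof -
    have "real (r choose k) \<le> 2 ^ r"
      using binomial_le_pow2[of r k] by (metis of_nat_le_iff of_nat_numeral of_nat_power)
    then have "real (r choose k) * binomial_moment n r \<le> 2 ^ r * config_total r"
      using binomial_moment_bounds[of n r] by (intro mult_mono) auto
    then show ?thesis using binomial_moment_bounds[of n r] by (simp add: abs_mult mult.commute)
  qed
  have "(\<lambda>n. (-1) ^ (r + k) * real (r choose k) * binomial_moment n r) \<longlonglongrightarrow>
      (-1) ^ (r + k) * real (r choose k) * (config_total r * exp (- real r))" for r
    by (intro tendsto_intros binomial_moment_tendsto)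
  moreover have "\<forall>\<^sub>F (r, n) in sequentially \<times>\<^sub>F sequentially.
      norm ((-1) ^ (r + k) * real (r choose k) * binomial_moment n r) \<le> config_total r * 2 ^ r"
    by (intro always_eventually) (simp only: case_prod_beta bound, simp)
  ultimately have "(\<lambda>n. \<Sum>r. (-1) ^ (r + k) * real (r choose k) * binomial_moment n r) \<longlonglongrightarrow>
      (\<Sum>r. (-1) ^ (r + k) * real (r choose k) * (config_total r * exp (- real r)))"
    by (rule tannerys_theorem[THEN conjunct2, THEN conjunct2]) (simp_all add: summable_config_total)
  moreover have "\<forall>\<^sub>F n in sequentially. prob_fixed_points n k =
      (\<Sum>r. (-1) ^ (r + k) * real (r choose k) * binomial_moment n r)"
    using eventually_ge_at_top[of 1] by eventually_elim (rule prob_fixed_points_eq)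
  ultimately show ?thesis by (simp add: tendsto_cong)
qed

text \<open>
  If \<open>m\<close> is the sequence of binomial moments of a distribution, the inner sums are its probabilities, and
  the generating function of the probabilities at \<open>u\<close> is that of the moments at \<open>u - 1\<close>. The double
  sum converges absolutely by the assumption, since \<open>(norm u + 1) ^ r\<close> is the sum of
  \<open>(r choose k) * norm u ^ k\<close>; so the order of summation may be exchanged.
\<close>

lemma binomial_inversion_sums:
  fixes m :: "nat \<Rightarrow> real" and u :: complex
  assumes m: "\<And>r. 0 \<le> m r" and abs: "summable (\<lambda>r. m r * (norm u + 1) ^ r)"
  shows "(\<lambda>k. complex_of_real (\<Sum>r. (-1) ^ (r + k) * real (r choose k) * m r) * u ^ k) sums
           (\<Sum>r. complex_of_real (m r) * (u - 1) ^ r)"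
proof -
  define f where "f = (\<lambda>(r, k). complex_of_real ((-1) ^ (r + k) * real (r choose k) * m r) * u ^ k)"
  have norm_f: "norm (f (r, k)) = m r * (real (r choose k) * norm u ^ k)" for r k
    using m[of r] by (simp add: f_def norm_mult norm_power)
  have zero: "f (r, k) = 0" if "r < k" for r k using that by (simp add: f_def binomial_eq_0)
  have row_norm: "((\<lambda>k. norm (f (r, k))) has_sum (m r * (norm u + 1) ^ r)) UNIV" for r
  proof (rule has_sum_finite_neutralI[where B = "{..r}"])
    show "m r * (norm u + 1) ^ r = (\<Sum>k\<le>r. norm (f (r, k)))"
      unfolding norm_f binomial_ring[of "norm u" 1 r] by (simp add: sum_distrib_left)
  qed (auto simp: zero)
  have row: "((\<lambda>k. f (r, k)) has_sum (complex_of_real (m r) * (u - 1) ^ r)) UNIV" for r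
  proof (rule has_sum_finite_neutralI[where B = "{..r}"])
    have "(u - 1) ^ r = (\<Sum>k\<le>r. of_nat (r choose k) * u ^ k * (-1) ^ (r - k))"
      using binomial_ring[of u "-1" r] by simp
    also have "\<dots> = (\<Sum>k\<le>r. (-1) ^ (r + k) * of_nat (r choose k) * u ^ k)"
      by (intro sum.cong refl) (auto simp: minus_one_power_iff)
    finally show "complex_of_real (m r) * (u - 1) ^ r = (\<Sum>k\<le>r. f (r, k))"
      by (simp add: f_def sum_distrib_left mult_ac)
  qed (auto simp: zero)
  have f_abs: "(\<lambda>x. norm (f x)) summable_on UNIV \<times> UNIV"
    unfolding Infinite_Sum.abs_summable_on_Sigma_iff
  proof (intro conjI ballI)
    show "(\<lambda>k. norm (f (r, k))) summable_on UNIV" for r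
      using row_norm[of r] by (auto simp: summable_on_def)
    have "(\<lambda>r. norm (m r * (norm u + 1) ^ r)) summable_on UNIV"
      using abs m by (intro norm_summable_imp_summable_on) (simp add: abs_mult)
    then show "(\<lambda>r. norm (infsum (\<lambda>k. norm (f (r, k))) UNIV)) summable_on UNIV"
      by (simp only: infsumI[OF row_norm])
  qed
  have f_summable: "(\<lambda>(r, k). f (r, k)) summable_on UNIV \<times> UNIV"
    using Infinite_Sum.abs_summable_summable[OF f_abs] by simp
  have swapped_summable: "(\<lambda>(k, r). f (r, k)) summable_on UNIV \<times> UNIV"
    using f_summable summable_on_swap[of "\<lambda>(k, r). f (r, k)" UNIV UNIV] by simp
  have column: "infsum (\<lambda>r. f (r, k)) UNIV =
      complex_of_real (\<Sum>r. (-1) ^ (r + k) * real (r choose k) * m r) * u ^ k" for k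
  proof -
    define g where "g = (\<lambda>r. (-1) ^ (r + k) * real (r choose k) * m r)"
    have f_g: "f (r, k) = complex_of_real (g r) * u ^ k" for r by (simp add: f_def g_def)
    have "(\<lambda>r. f (r, k)) summable_on UNIV"
      using summable_on_SigmaD1[OF swapped_summable, of k] by simp
    then have sums: "(\<lambda>r. complex_of_real (g r) * u ^ k) sums infsum (\<lambda>r. f (r, k)) UNIV"
      unfolding f_g by (intro has_sum_imp_sums has_sum_infsum)
    have "(\<Sum>r. complex_of_real (g r) * u ^ k) = complex_of_real (suminf g) * u ^ k"
    proof (cases "u ^ k = 0")
      case False
      have "summable (\<lambda>r. complex_of_real (g r))"
        using summable_mult2[OF sums_summable[OF sums], of "inverse (u ^ k)"] False
        by (simp add: mult.assoc)
      then show ?thesis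
        using suminf_of_real[of g, where 'a = complex] by (simp add: suminf_mult2 [symmetric])
    next
      case True
      then show ?thesis by (simp only: mult_zero_right suminf_zero)
    qed
    then have "infsum (\<lambda>r. f (r, k)) UNIV = complex_of_real (suminf g) * u ^ k"
      using sums_unique[OF sums] by (simp only:)
    then show ?thesis unfolding g_def .
  qed
  have "(\<lambda>k. infsum (\<lambda>r. f (r, k)) UNIV) summable_on UNIV"
    using summable_on_Sigma_banach[OF swapped_summable] .
  then have columns: "(\<lambda>k. infsum (\<lambda>r. f (r, k)) UNIV) sums
      infsum (\<lambda>k. infsum (\<lambda>r. f (r, k)) UNIV) UNIV"
    by (intro has_sum_imp_sums has_sum_infsum)
  have "(\<lambda>r. infsum (\<lambda>k. f (r, k)) UNIV) summable_on UNIV"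
    using summable_on_Sigma_banach[OF f_summable] .
  then have "(\<lambda>r. infsum (\<lambda>k. f (r, k)) UNIV) sums
      infsum (\<lambda>r. infsum (\<lambda>k. f (r, k)) UNIV) UNIV"
    by (intro has_sum_imp_sums has_sum_infsum)
  then have "(\<Sum>r. complex_of_real (m r) * (u - 1) ^ r) =
      infsum (\<lambda>r. infsum (\<lambda>k. f (r, k)) UNIV) UNIV"
    by (simp add: infsumI[OF row] sums_iff)
  also have "\<dots> = infsum (\<lambda>k. infsum (\<lambda>r. f (r, k)) UNIV) UNIV"
    by (rule infsum_swap_banach[OF f_summable])
  finally show ?thesis using columns by (simp only: column)
qed

theorem theorem17:
  shows "\<exists>p :: nat \<Rightarrow> real.
           (\<forall>k. (\<lambda>n. prob_fixed_points n k) \<longlonglongrightarrow> p k) \<and>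
           (\<forall>u :: complex. (\<lambda>k. complex_of_real (p k) * u ^ k) sums q u)"
proof (intro exI conjI allI)
  \<comment> \<open>\<open>m r\<close> is the limit of the expectations of \<open>X choose r\<close>.\<close>
  define m where "m r = config_total r * exp (- real r)" for r
  define p where "p k = (\<Sum>r. (-1) ^ (r + k) * real (r choose k) * m r)" for k
  show "(\<lambda>n. prob_fixed_points n k) \<longlonglongrightarrow> p k" for k
    unfolding p_def m_def by (rule prob_fixed_points_tendsto)
  fix u :: complex
  have exp_neg: "exp (- real r) = exp (-1) ^ r" for r
    by (simp flip: exp_of_nat_mult)
  have m_power: "m r * x ^ r = config_total r * (exp (-1) * x) ^ r" for r x
    unfolding m_def exp_neg by (simp add: power_mult_distrib)
  have "summable (\<lambda>r. m r * (norm u + 1) ^ r)"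
    unfolding m_power by (rule summable_config_total)
  moreover have "0 \<le> m r" for r by (simp add: m_def config_total_nonneg)
  ultimately have "(\<lambda>k. complex_of_real (p k) * u ^ k) sums
      (\<Sum>r. complex_of_real (m r) * (u - 1) ^ r)"
    unfolding p_def by (intro binomial_inversion_sums)
  moreover have "complex_of_real (m r) * (u - 1) ^ r =
      complex_of_real (config_total r) * (exp (-1) * (u - 1)) ^ r" for r
    unfolding m_def exp_neg by (simp add: power_mult_distrib exp_of_real[symmetric])
  ultimately have "(\<lambda>k. complex_of_real (p k) * u ^ k) sums
      exp (of_real (2 * exp 1 - 3) * (exp (-1) * (u - 1)) + (exp (-1) * (u - 1))\<^sup>2 / 2)"
    using config_total_power_series[of "exp (-1) * (u - 1)"] by (simp add: sums_iff)
  moreover have "exp (of_real (2 * exp 1 - 3) * (exp (-1) * (u - 1)) + (exp (-1) * (u - 1))\<^sup>2 / 2) = q u"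
  proof -
    have e1: "complex_of_real (2 * exp 1 - 3) = 2 * exp 1 - 3"
      using exp_of_real[of 1, where 'a = complex] by simp
    have e: "exp (1::complex) * exp (-1) = 1" by (simp flip: exp_add)
    have e2: "exp (-2::complex) = exp (-1) ^ 2" by (simp add: power2_eq_square flip: exp_add)
    have "of_real (2 * exp 1 - 3) * (exp (-1) * (u - 1)) + (exp (-1) * (u - 1))\<^sup>2 / 2 =
        2 * (exp 1 * exp (-1)) * (u - 1) - 3 * exp (-1) * (u - 1) + exp (-1) ^ 2 * (u - 1)\<^sup>2 / 2"
      unfolding e1 by (simp add: algebra_simps power2_eq_square)
    also have "\<dots> = 1 / 2 * (u - 1) * (u * exp (-2) - 6 * exp (-1) + 4 - exp (-2))"
      unfolding e e2 by (simp add: field_simps power2_eq_square)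
    finally show ?thesis unfolding q_def by (rule arg_cong)
  qed
  ultimately show "(\<lambda>k. complex_of_real (p k) * u ^ k) sums q u" by simp
qed

end
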